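(* Let $\theta$ be an inner function with $0$-th Fourier coefficient $\theta_0$, let $\phi\in L^\infty$, and let $A$ be a bounded linear operator on $K_\theta^\perp$ satisfying $$AU_\theta^*-U_\theta A=\theta\otimes Q_\theta J(\alpha_{\phi^*})-Q_\theta J(\alpha_\phi)\otimes\theta,$$ where $\alpha_\phi=\phi\bar z(\theta-\theta_0)$ and $\alpha_{\phi^*}=\phi^*\bar z(\theta-\theta_0)$. Then: (a) if $\theta_0\neq0$, then $A=\mathcal{H}_\phi^\theta$ if and only if $A\bar z=\mathcal{H}_\phi^\theta(\bar z)$; (b) if $\theta_0=0$, then $A=\mathcal{H}_\phi^\theta$ if and only if $A\bar z=\mathcal{H}_\phi^\theta(\bar z)$ and $A^*\bar z=(\mathcal{H}_\phi^\theta)^*(\bar z)$.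
   Context: $\mathbb{T}$ is the unit circle with normalized Lebesgue measure, $L^2=L^2(\mathbb{T})$ with inner product $\langle\cdot,\cdot\rangle$ linear in the first entry, $L^\infty=L^\infty(\mathbb{T})$. $H^2\subset L^2$ is the Hardy space (functions whose negative Fourier coefficients vanish), $H_0^2=zH^2$, $\overline{H_0^2}=L^2\ominus H^2$. $P:L^2\to H^2$ is the orthogonal projection and $Q=I-P$ is the orthogonal projection onto $\overline{H_0^2}$. The flip $J$ on $L^2$ is $(Jf)(z)=f(\bar z)$, $z\in\mathbb{T}$. For an inner function $\theta$ (bounded analytic on the disk, unimodular a.e. on $\mathbb{T}$), $K_\theta=H^2\ominus\theta H^2$ and $K_\theta^\perp=L^2\ominus K_\theta=\overline{H_0^2}\oplus\theta H^2$; $Q_\theta=Q+\theta P\bar\theta$ is the orthogonal projection of $L^2$ onto $K_\theta^\perp$. For $\phi\in L^\infty$ the dual truncated Hankel operator is $\mathcal{H}_\phi^\theta:K_\theta^\perp\to K_\theta^\perp$, $\mathcal{H}_\phi^\theta(h)=Q_\theta J(\phi h)$. The compressed shift on $K_\theta^\perp$ is $U_\theta h=Q_\theta(zh)$. For $f,g$ in a Hilbert space, $f\otimes g$ is the operator $h\mapsto\langle h,g\rangle f$. For $\phi\in L^2$, $\phi^*(z)=\overline{\phi(\bar z)}$ on $\mathbb{T}$. *)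

theory Defs
  imports "HOL-Analysis.Analysis"
begin

section \<open>The circle and its normalized Lebesgue measure\<close>

text \<open>
  Functions on the unit circle are represented by functions on the complex plane;
  since the measure below is carried by the circle, values elsewhere are irrelevant.
\<close>

definition circle_measure :: "complex measure" where
  "circle_measure = distr (uniform_measure lborel {-pi..pi}) borel cis"

lemma sets_circle_measure [simp, measurable_cong]: "sets circle_measure = sets borel"
  by (simp add: circle_measure_def)

lemma space_circle_measure [simp]: "space circle_measure = UNIV"
  by (simp add: circle_measure_def)

lemma cis_measurable [measurable]: "cis \<in> borel_measurable borel"
  by (intro borel_measurable_continuous_onI continuous_intros)

lemma cnj_measurable [measurable]: "cnj \<in> borel_measurable borel"
  by (intro borel_measurable_continuous_onI continuous_intros)

lemma emeasure_circle_measure_UNIV: "emeasure circle_measure UNIV = 1"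
  unfolding circle_measure_def
  by (subst emeasure_distr) (auto intro!: emeasure_uniform_measure_1)

lemma AE_circle_measure_norm: "AE z in circle_measure. norm z = 1"
  unfolding circle_measure_def by (subst AE_distr_iff) auto

lemma distr_circle_measure_cnj: "distr circle_measure borel cnj = circle_measure"
proof -
  let ?u = "uniform_measure lborel {-pi..pi}"
  have *: "distr ?u borel uminus = ?u"
  proof (rule measure_eqI)
    show "sets (distr ?u borel uminus) = sets ?u" by simp
  next
    fix A assume "A \<in> sets (distr ?u borel uminus)"
    then have A [measurable]: "A \<in> sets borel" by simp
    have m: "uminus -` A \<in> sets (borel :: real measure)"
      using measurable_sets[of uminus borel borel A] by simp
    have "emeasure lborel ({-pi..pi} \<inter> uminus -` A)
        = emeasure lborel (uminus -` ({-pi..pi} \<inter> A))"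
      by (rule arg_cong[where f = "emeasure lborel"]) auto
    also have "\<dots> = emeasure (distr lborel borel uminus) ({-pi..pi} \<inter> A)"
      by (subst emeasure_distr) auto
    also have "\<dots> = emeasure lborel ({-pi..pi} \<inter> A)"
      by (simp add: lborel_distr_uminus)
    finally show "emeasure (distr ?u borel uminus) A = emeasure ?u A"
      using m by (subst emeasure_distr) auto
  qed
  have "distr circle_measure borel cnj = distr ?u borel (cnj \<circ> cis)"
    unfolding circle_measure_def by (subst distr_distr) auto
  also have "cnj \<circ> cis = cis \<circ> uminus" by (auto simp: cis_cnj)
  also have "distr ?u borel (cis \<circ> uminus) = distr (distr ?u borel uminus) borel cis"
    by (subst distr_distr) auto
  finally show ?thesis by (simp add: * circle_measure_def)
qed


section \<open>The Hilbert space of square-integrable functions on the circle\<close>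

definition square_integrable :: "(complex \<Rightarrow> complex) \<Rightarrow> bool" where
  "square_integrable f \<longleftrightarrow>
     f \<in> borel_measurable circle_measure \<and> integrable circle_measure (\<lambda>z. (norm (f z))\<^sup>2)"

lemma square_integrable_measurable [measurable_dest]:
  "square_integrable f \<Longrightarrow> f \<in> borel_measurable circle_measure"
  by (simp add: square_integrable_def)

lemma square_integrable_zero: "square_integrable (\<lambda>z. 0)"
  by (simp add: square_integrable_def)

lemma square_integrable_add:
  assumes "square_integrable f" "square_integrable g"
  shows "square_integrable (\<lambda>z. f z + g z)"
proof -
  note [measurable] = assms[THEN square_integrable_measurable]
  have "integrable circle_measure (\<lambda>z. 2 * (norm (f z))\<^sup>2 + 2 * (norm (g z))\<^sup>2)"
    using assms by (simp add: square_integrable_def)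
  then have "integrable circle_measure (\<lambda>z. (norm (f z + g z))\<^sup>2)"
  proof (rule Bochner_Integration.integrable_bound)
    show "AE z in circle_measure. norm ((norm (f z + g z))\<^sup>2)
        \<le> norm (2 * (norm (f z))\<^sup>2 + 2 * (norm (g z))\<^sup>2)"
    proof (rule AE_I2)
      fix z
      have "(norm (f z + g z))\<^sup>2 \<le> (norm (f z) + norm (g z))\<^sup>2"
        by (intro power_mono norm_triangle_ineq) auto
      also have "\<dots> \<le> 2 * (norm (f z))\<^sup>2 + 2 * (norm (g z))\<^sup>2"
        using sum_squares_bound[of "norm (f z)" "norm (g z)"]
        by (simp add: power2_sum)
      finally show "norm ((norm (f z + g z))\<^sup>2) \<le> norm (2 * (norm (f z))\<^sup>2 + 2 * (norm (g z))\<^sup>2)"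
        by simp
    qed
  qed auto
  then show ?thesis by (simp add: square_integrable_def)
qed

lemma square_integrable_bounded_mult:
  assumes "square_integrable f" "\<phi> \<in> borel_measurable circle_measure"
    and "AE z in circle_measure. norm (\<phi> z) \<le> C"
  shows "square_integrable (\<lambda>z. \<phi> z * f z)"
proof -
  note [measurable] = assms(1)[THEN square_integrable_measurable] assms(2)
  have "integrable circle_measure (\<lambda>z. C\<^sup>2 * (norm (f z))\<^sup>2)"
    using assms by (simp add: square_integrable_def)
  then have "integrable circle_measure (\<lambda>z. (norm (\<phi> z * f z))\<^sup>2)"
  proof (rule Bochner_Integration.integrable_bound)
    show "AE z in circle_measure. norm ((norm (\<phi> z * f z))\<^sup>2) \<le> norm (C\<^sup>2 * (norm (f z))\<^sup>2)"
      using assms(3)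
    proof eventually_elim
      case (elim z)
      then have "(norm (\<phi> z))\<^sup>2 \<le> C\<^sup>2" by (intro power_mono) auto
      then show ?case by (simp add: norm_mult power_mult_distrib mult_right_mono)
    qed
  qed auto
  then show ?thesis by (simp add: square_integrable_def)
qed

lemma square_integrable_scale: "square_integrable f \<Longrightarrow> square_integrable (\<lambda>z. c * f z)"
  by (rule square_integrable_bounded_mult[where C = "norm c"]) auto

lemma integrable_mult_cnj:
  assumes "square_integrable f" "square_integrable g"
  shows "integrable circle_measure (\<lambda>z. f z * cnj (g z))"
proof -
  note [measurable] = assms[THEN square_integrable_measurable]
  have "integrable circle_measure (\<lambda>z. (norm (f z))\<^sup>2 + (norm (g z))\<^sup>2)"
    using assms by (simp add: square_integrable_def)
  then show ?thesis
  proof (rule Bochner_Integration.integrable_bound)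
    show "AE z in circle_measure. norm (f z * cnj (g z))
        \<le> norm ((norm (f z))\<^sup>2 + (norm (g z))\<^sup>2)"
    proof (rule AE_I2)
      fix z
      have "2 * (norm (f z) * norm (g z)) \<le> (norm (f z))\<^sup>2 + (norm (g z))\<^sup>2"
        using sum_squares_bound[of "norm (f z)" "norm (g z)"] by simp
      moreover have "0 \<le> norm (f z) * norm (g z)" by simp
      ultimately have "norm (f z) * norm (g z) \<le> (norm (f z))\<^sup>2 + (norm (g z))\<^sup>2"
        by linarith
      then show "norm (f z * cnj (g z)) \<le> norm ((norm (f z))\<^sup>2 + (norm (g z))\<^sup>2)"
        by (simp add: norm_mult)
    qed
  qed auto
qed

lemma integral_mult_cnj_self:
  "(LINT z|circle_measure. f z * cnj (f z))
     = complex_of_real (LINT z|circle_measure. (norm (f z))\<^sup>2)"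
  by (simp only: integral_complex_of_real[symmetric] complex_norm_square)

quotient_type L2 = "complex \<Rightarrow> complex" / partial:
  "\<lambda>f g. square_integrable f \<and> square_integrable g \<and> (AE z in circle_measure. f z = g z)"
proof (rule part_equivpI)
  show "\<exists>f. square_integrable f \<and> square_integrable f \<and> (AE z in circle_measure. f z = f z)"
    using square_integrable_zero by (intro exI[of _ "\<lambda>z. 0"]) simp
qed (auto intro!: sympI transpI elim: AE_mp)

text \<open>
  \<open>abs_L2 f\<close> is the class of a square-integrable function \<open>f\<close> (it is unspecified for other
  functions), and \<open>rep_L2 h\<close> is some representative of the class \<open>h\<close>.
\<close>

instantiation L2 :: real_inner
begin

lift_definition zero_L2 :: L2 is "\<lambda>z. 0"
  by (simp add: square_integrable_zero)

lift_definition plus_L2 :: "L2 \<Rightarrow> L2 \<Rightarrow> L2" is "\<lambda>f g z. f z + g z"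
  by (auto simp: square_integrable_add)

lift_definition uminus_L2 :: "L2 \<Rightarrow> L2" is "\<lambda>f z. - f z"
  using square_integrable_scale[of _ "-1"] by auto

definition minus_L2 :: "L2 \<Rightarrow> L2 \<Rightarrow> L2" where
  "minus_L2 f g = f + (- g)"

lift_definition scaleR_L2 :: "real \<Rightarrow> L2 \<Rightarrow> L2" is "\<lambda>r f z. complex_of_real r * f z"
  by (auto simp: square_integrable_scale)

lift_definition inner_L2 :: "L2 \<Rightarrow> L2 \<Rightarrow> real"
  is "\<lambda>f g. Re (LINT z|circle_measure. f z * cnj (g z))"
  by (rule arg_cong[where f = Re], rule integral_cong_AE)
     (auto elim!: eventually_elim2 dest!: square_integrable_measurable)

definition norm_L2 :: "L2 \<Rightarrow> real" where
  "norm_L2 f = sqrt (inner f f)"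

definition sgn_L2 :: "L2 \<Rightarrow> L2" where
  "sgn_L2 f = scaleR (inverse (norm f)) f"

definition dist_L2 :: "L2 \<Rightarrow> L2 \<Rightarrow> real" where
  "dist_L2 f g = norm (f - g)"

definition uniformity_L2 :: "(L2 \<times> L2) filter" where
  "uniformity_L2 = (INF e\<in>{0<..}. principal {(x, y). dist x y < e})"

definition open_L2 :: "L2 set \<Rightarrow> bool" where
  "open_L2 U \<longleftrightarrow> (\<forall>x\<in>U. \<forall>\<^sub>F (x', y) in uniformity. x' = x \<longrightarrow> y \<in> U)"

instance
proof
  fix f g h :: L2 and a b :: real
  show "f + g + h = f + (g + h)"
    by transfer (auto intro!: square_integrable_add simp: add.assoc)
  show "f + g = g + f"
    by transfer (auto intro!: square_integrable_add simp: add.commute)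
  show "0 + f = f" by transfer auto
  show "- f + f = 0"
    by transfer (auto simp: square_integrable_zero)
  show "f - g = f + - g" by (simp add: minus_L2_def)
  show "a *\<^sub>R (f + g) = a *\<^sub>R f + a *\<^sub>R g"
    by transfer (auto intro!: square_integrable_add square_integrable_scale simp: ring_distribs)
  show "(a + b) *\<^sub>R f = a *\<^sub>R f + b *\<^sub>R f"
    by transfer (auto intro!: square_integrable_add square_integrable_scale simp: ring_distribs)
  show "a *\<^sub>R b *\<^sub>R f = (a * b) *\<^sub>R f"
    by transfer (auto intro!: square_integrable_scale simp: mult.assoc)
  show "1 *\<^sub>R f = f" by transfer auto
  show "sgn f = scaleR (inverse (norm f)) f" by (simp add: sgn_L2_def)
  show "dist f g = norm (f - g)" by (simp add: dist_L2_def)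
  show "uniformity = (INF e\<in>{0<..}. principal {(x :: L2, y). dist x y < e})"
    by (simp add: uniformity_L2_def)
  show "open U \<longleftrightarrow> (\<forall>x\<in>U. \<forall>\<^sub>F (x', y) in uniformity. x' = x \<longrightarrow> y \<in> U)" for U :: "L2 set"
    by (simp add: open_L2_def)
  show "inner f g = inner g f"
  proof transfer
    fix f g :: "complex \<Rightarrow> complex"
    have "(LINT z|circle_measure. g z * cnj (f z)) = (LINT z|circle_measure. cnj (f z * cnj (g z)))"
      by (simp add: mult.commute)
    also have "\<dots> = cnj (LINT z|circle_measure. f z * cnj (g z))"
      by (rule Bochner_Integration.integral_cnj)
    finally show "Re (LINT z|circle_measure. f z * cnj (g z))
        = Re (LINT z|circle_measure. g z * cnj (f z))" by simp
  qed
  show "inner (f + g) h = inner f h + inner g h"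
    by transfer (simp add: ring_distribs integrable_mult_cnj)
  show "inner (a *\<^sub>R f) g = a * inner f g"
    by transfer (simp add: mult.assoc)
  show "0 \<le> inner f f"
    by transfer (simp add: integral_mult_cnj_self)
  show "inner f f = 0 \<longleftrightarrow> f = 0"
  proof transfer
    fix f :: "complex \<Rightarrow> complex"
    assume "square_integrable f \<and> square_integrable f \<and> (AE z in circle_measure. f z = f z)"
    then have f: "square_integrable f" by simp
    have "(LINT z|circle_measure. (norm (f z))\<^sup>2) = 0
        \<longleftrightarrow> (AE z in circle_measure. (norm (f z))\<^sup>2 = 0)"
      using f by (intro integral_nonneg_eq_0_iff_AE) (auto simp: square_integrable_def)
    with f show "(Re (LINT z|circle_measure. f z * cnj (f z)) = 0) \<longleftrightarrow>
        (square_integrable f \<and> square_integrable (\<lambda>z. 0) \<and> (AE z in circle_measure. f z = 0))"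
      by (simp add: integral_mult_cnj_self square_integrable_zero)
  qed
  show "norm f = sqrt (inner f f)" by (simp add: norm_L2_def)
qed

end

text \<open>
  The class \<open>real_inner\<close> provides the norm; the complex scalar multiplication and the complex inner
  product, linear in the first entry, are added separately.
\<close>

lift_definition scaleC :: "complex \<Rightarrow> L2 \<Rightarrow> L2" is "\<lambda>c f z. c * f z"
  by (auto simp: square_integrable_scale)

lift_definition cinner :: "L2 \<Rightarrow> L2 \<Rightarrow> complex"
  is "\<lambda>f g. LINT z|circle_measure. f z * cnj (g z)"
  by (rule integral_cong_AE)
     (auto elim!: eventually_elim2 dest!: square_integrable_measurable)

lemma inner_eq_Re_cinner: "inner f g = Re (cinner f g)"
  by transfer simp

lemma cinner_self: "cinner f f = complex_of_real ((norm f)\<^sup>2)"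
proof -
  have "cinner f f = complex_of_real (Re (cinner f f))"
    by transfer (simp add: integral_mult_cnj_self)
  then show ?thesis
    by (simp add: inner_eq_Re_cinner[symmetric] power2_norm_eq_inner)
qed


section \<open>Operators on subspaces\<close>

text \<open>
  An operator on a subspace \<open>M\<close> is represented by a function on the whole space,
  of which only the values on \<open>M\<close> matter. The descriptions below denote the adjoint and the
  orthogonal projection when \<open>M\<close> is a closed complex subspace and \<open>A\<close> is a bounded operator on \<open>M\<close>.
\<close>

definition bounded_operator_on :: "L2 set \<Rightarrow> (L2 \<Rightarrow> L2) \<Rightarrow> bool" where
  "bounded_operator_on M A \<longleftrightarrow>
     A ` M \<subseteq> M \<and>
     (\<forall>f\<in>M. \<forall>g\<in>M. A (f + g) = A f + A g) \<and>
     (\<forall>c. \<forall>f\<in>M. A (scaleC c f) = scaleC c (A f)) \<and>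
     (\<exists>C. \<forall>f\<in>M. norm (A f) \<le> C * norm f)"

definition adjoint_on :: "L2 set \<Rightarrow> (L2 \<Rightarrow> L2) \<Rightarrow> L2 \<Rightarrow> L2" where
  "adjoint_on M A g = (THE w. w \<in> M \<and> (\<forall>f\<in>M. cinner (A f) g = cinner f w))"

definition orthogonal_proj :: "L2 set \<Rightarrow> L2 \<Rightarrow> L2" where
  "orthogonal_proj M f = (THE g. g \<in> M \<and> (\<forall>h\<in>M. cinner (f - g) h = 0))"

definition ominus :: "L2 set \<Rightarrow> L2 set \<Rightarrow> L2 set"  (infixl "\<ominus>\<^sub>L" 65) where
  "M \<ominus>\<^sub>L N = {f \<in> M. \<forall>g\<in>N. cinner f g = 0}"

definition rank_one :: "L2 \<Rightarrow> L2 \<Rightarrow> L2 \<Rightarrow> L2"  (infix "\<otimes>\<^sub>L" 70) where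
  "(f \<otimes>\<^sub>L g) h = scaleC (cinner h g) f"


section \<open>Hardy space, inner functions and model spaces\<close>

definition fourier_coeff :: "(complex \<Rightarrow> complex) \<Rightarrow> int \<Rightarrow> complex" where
  "fourier_coeff f n = (LINT z|circle_measure. f z * z powi (- n))"

definition Linf :: "(complex \<Rightarrow> complex) set" where
  "Linf = {\<phi> \<in> borel_measurable circle_measure. \<exists>C. AE z in circle_measure. norm (\<phi> z) \<le> C}"

text \<open>Multiplication by an essentially bounded function.\<close>

definition mult_op :: "(complex \<Rightarrow> complex) \<Rightarrow> L2 \<Rightarrow> L2" where
  "mult_op \<phi> h = abs_L2 (\<lambda>z. \<phi> z * rep_L2 h z)"

lemma mult_op_abs_L2:
  assumes "\<phi> \<in> Linf" "square_integrable f"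
  shows "mult_op \<phi> (abs_L2 f) = abs_L2 (\<lambda>z. \<phi> z * f z)"
proof -
  obtain C where C: "\<phi> \<in> borel_measurable circle_measure" "AE z in circle_measure. norm (\<phi> z) \<le> C"
    using assms by (auto simp: Linf_def)
  have "square_integrable (rep_L2 (abs_L2 f)) \<and> square_integrable f
      \<and> (AE z in circle_measure. rep_L2 (abs_L2 f) z = f z)"
    by (rule Quotient_rep_abs[OF Quotient_L2]) (simp add: assms)
  then show ?thesis
    unfolding mult_op_def
    by (intro Quotient_rel_abs[OF Quotient_L2])
       (auto intro: square_integrable_bounded_mult[OF _ C] elim!: eventually_mono)
qed

lift_definition flip :: "L2 \<Rightarrow> L2" is "\<lambda>f z. f (cnj z)"
proof -
  fix f g :: "complex \<Rightarrow> complex"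
  assume *: "square_integrable f \<and> square_integrable g \<and> (AE z in circle_measure. f z = g z)"
  have sq: "square_integrable (\<lambda>z. h (cnj z))" if h: "square_integrable h" for h
  proof -
    have [measurable]: "h \<in> borel_measurable borel"
      using h by (auto simp: square_integrable_def cong: measurable_cong_sets)
    have "integrable (distr circle_measure borel cnj) (\<lambda>z. (norm (h z))\<^sup>2)"
      using h by (simp add: distr_circle_measure_cnj square_integrable_def)
    then have "integrable circle_measure (\<lambda>z. (norm (h (cnj z)))\<^sup>2)"
      by (subst (asm) integrable_distr_eq) auto
    then show ?thesis by (simp add: square_integrable_def)
  qed
  have [measurable]: "f \<in> borel_measurable borel" "g \<in> borel_measurable borel"
    using * by (auto simp: square_integrable_def cong: measurable_cong_sets)
  have "AE z in distr circle_measure borel cnj. f z = g z"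
    unfolding distr_circle_measure_cnj using * by blast
  then have "AE z in circle_measure. f (cnj z) = g (cnj z)"
    by (subst (asm) AE_distr_iff) auto
  with * sq show "square_integrable (\<lambda>z. f (cnj z)) \<and> square_integrable (\<lambda>z. g (cnj z))
      \<and> (AE z in circle_measure. f (cnj z) = g (cnj z))" by auto
qed

definition star :: "(complex \<Rightarrow> complex) \<Rightarrow> complex \<Rightarrow> complex" where
  "star \<phi> z = cnj (\<phi> (cnj z))"

text \<open>Fourier coefficients do not depend on the representative.\<close>

definition H2 :: "L2 set" where
  "H2 = {f. \<forall>n<0. fourier_coeff (rep_L2 f) n = 0}"

definition proj_P :: "L2 \<Rightarrow> L2" where
  "proj_P = orthogonal_proj H2"

definition proj_Q :: "L2 \<Rightarrow> L2" where
  "proj_Q f = f - proj_P f"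

text \<open>
  An inner function is given by its values on the circle, which are almost everywhere the
  radial limits of a bounded holomorphic function on the open unit disk.
\<close>

definition inner_fun :: "(complex \<Rightarrow> complex) \<Rightarrow> bool" where
  "inner_fun \<theta> \<longleftrightarrow>
     \<theta> \<in> borel_measurable circle_measure \<and>
     (AE z in circle_measure. norm (\<theta> z) = 1) \<and>
     (\<exists>F. F holomorphic_on ball 0 1 \<and> bounded (F ` ball 0 1) \<and>
        (AE z in circle_measure. ((\<lambda>r. F (complex_of_real r * z)) \<longlongrightarrow> \<theta> z) (at_left 1)))"

text \<open>The symbol \<open>\<theta>\<close> is a function; as a vector of \<open>L2\<close> it is \<open>abs_L2 \<theta>\<close>.\<close>

definition K_space :: "(complex \<Rightarrow> complex) \<Rightarrow> L2 set" where
  "K_space \<theta> = H2 \<ominus>\<^sub>L mult_op \<theta> ` H2"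

definition K_perp :: "(complex \<Rightarrow> complex) \<Rightarrow> L2 set" where
  "K_perp \<theta> = UNIV \<ominus>\<^sub>L K_space \<theta>"

definition proj_Q\<theta> :: "(complex \<Rightarrow> complex) \<Rightarrow> L2 \<Rightarrow> L2" where
  "proj_Q\<theta> \<theta> f = proj_Q f + mult_op \<theta> (proj_P (mult_op (\<lambda>z. cnj (\<theta> z)) f))"

text \<open>The dual truncated Hankel operator and the compressed shift.\<close>

definition dual_hankel :: "(complex \<Rightarrow> complex) \<Rightarrow> (complex \<Rightarrow> complex) \<Rightarrow> L2 \<Rightarrow> L2" where
  "dual_hankel \<theta> \<phi> h = proj_Q\<theta> \<theta> (flip (mult_op \<phi> h))"

definition compressed_shift :: "(complex \<Rightarrow> complex) \<Rightarrow> L2 \<Rightarrow> L2" where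
  "compressed_shift \<theta> h = proj_Q\<theta> \<theta> (mult_op (\<lambda>z. z) h)"

text \<open>On the circle, the conjugate of \<open>z\<close> is the inverse of \<open>z\<close>.\<close>

definition alpha :: "(complex \<Rightarrow> complex) \<Rightarrow> (complex \<Rightarrow> complex) \<Rightarrow> L2" where
  "alpha \<theta> \<phi> = abs_L2 (\<lambda>z. \<phi> z * cnj z * (\<theta> z - fourier_coeff \<theta> 0))"

end

theory Submission
  imports Defs "HOL-Complex_Analysis.Cauchy_Integral_Formula"
begin

text \<open>
  The hypothesis on \<open>A\<close> is a linear equation that the dual truncated Hankel operator \<open>H\<close> satisfies
  as well (\<open>dual_hankel_commutator\<close>). Consequently the difference \<open>D = A - H\<close> intertwines the
  compressed shift \<open>U\<close> with its adjoint, \<open>D U\<^sup>* = U D\<close>, and the assertion is that the stated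
  conditions force such a \<open>D\<close> to vanish (\<open>intertwining_operator_eq_zero\<close>).

  The space \<open>K_perp \<theta>\<close> is the closed span of the powers \<open>z\<^sup>-\<^sup>n\<close> with \<open>n \<ge> 1\<close> and of \<open>\<theta> z\<^sup>n\<close> with \<open>n \<ge> 0\<close>, and
  \<open>U\<^sup>*\<close> acts on them as the chain
  \<open>\<dots> \<rightarrow> \<theta> z \<rightarrow> \<theta> \<rightarrow> \<theta>0 / z\<close> followed by \<open>1 / z \<rightarrow> z\<^sup>-\<^sup>2 \<rightarrow> \<dots>\<close>, where \<open>\<theta>0\<close> is the coefficient of \<open>\<theta>\<close> of
  index zero. If \<open>D (1 / z) = 0\<close>, the relation \<open>D U\<^sup>* = U D\<close> propagates this forward along the
  negative powers. In the other direction it only gives that \<open>U\<close> annihilates \<open>D \<theta>\<close>, then \<open>D (\<theta> z)\<close>, and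
  so on. For \<open>\<theta>0 \<noteq> 0\<close> the operator \<open>U\<close> is injective and \<open>D = 0\<close> follows. For \<open>\<theta>0 = 0\<close> its kernel is
  spanned by \<open>1 / z\<close>, and the condition on the adjoint at \<open>1 / z\<close> says that the range of \<open>D\<close> is
  orthogonal to this kernel (\<open>compressed_shift_eq_zero\<close>).

  Projections and adjoints are definite descriptions, so their existence has to be established:
  this rests on the completeness of \<open>L2\<close> (the theorem of Riesz and Fischer), the projection theorem
  and the Riesz representation theorem. The density statement rests on the uniqueness of Fourier
  coefficients (\<open>vanishing_fourier_AE_zero\<close>) and on the fact that inner functions, which are defined
  by radial limits, have no negative Fourier coefficients (\<open>inner_fun_in_H2\<close>).
\<close>

section \<open>Projections and the Riesz representation in real Hilbert spaces\<close>

theorem orthogonal_projection_exists: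
  fixes f :: "'a::{real_inner,complete_space}"
  assumes S: "subspace S" "closed S"
  shows "\<exists>g\<in>S. \<forall>h\<in>S. inner (f - g) h = 0"
proof -
  define q where "q g = (norm (f - g))\<^sup>2" for g
  define d where "d = (INF g\<in>S. q g)"
  have S0: "S \<noteq> {}" using S subspace_0 by blast
  have bdd: "bdd_below (q ` S)" unfolding q_def by (rule bdd_belowI[of _ 0]) auto
  have d_le: "d \<le> q g" if "g \<in> S" for g
    unfolding d_def by (rule cINF_lower[OF bdd that])
  have "\<exists>g\<in>S. q g < d + 1 / real (Suc n)" for n
  proof -
    have "d < d + 1 / real (Suc n)" by simp
    then show ?thesis unfolding d_def using cINF_less_iff[OF S0 bdd] by blast
  qed
  then obtain x where x: "\<And>n. x n \<in> S" "\<And>n. q (x n) < d + 1 / real (Suc n)"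
    by metis
  \<comment> \<open>By the parallelogram law a minimizing sequence is a Cauchy sequence.\<close>
  have par: "(norm (a - b))\<^sup>2 \<le> 2 * (q a - d) + 2 * (q b - d)" if "a \<in> S" "b \<in> S" for a b
  proof -
    define m where "m = (1/2) *\<^sub>R (a + b)"
    have "m \<in> S" unfolding m_def using S(1) that by (intro subspace_scale subspace_add)
    then have "d \<le> q m" by (rule d_le)
    moreover have "(norm (a - b))\<^sup>2 = 2 * q a + 2 * q b - 4 * q m"
      unfolding q_def m_def power2_norm_eq_inner
      by (simp add: algebra_simps inner_commute)
    ultimately show ?thesis by (simp add: algebra_simps)
  qed
  have "Cauchy x"
  proof (rule metric_CauchyI)
    fix e :: real assume e: "e > 0"
    obtain N where N: "1 / real (Suc N) < e\<^sup>2 / 4"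
      using reals_Archimedean[of "e\<^sup>2/4"] e by (auto simp: inverse_eq_divide)
    have sm: "q (x n) - d < e\<^sup>2 / 4" if "n \<ge> N" for n
    proof -
      have "1 / real (Suc n) \<le> 1 / real (Suc N)" using that by (simp add: frac_le)
      then show ?thesis using x(2)[of n] N by linarith
    qed
    show "\<exists>M. \<forall>m\<ge>M. \<forall>n\<ge>M. dist (x m) (x n) < e"
    proof (intro exI allI impI)
      fix m n assume "N \<le> m" "N \<le> n"
      then have "(norm (x m - x n))\<^sup>2 < e\<^sup>2"
        using par[OF x(1) x(1), of m n] sm[of m] sm[of n] by (simp add: algebra_simps)
      then show "dist (x m) (x n) < e"
        using e by (simp add: dist_norm power2_less_imp_less)
    qed
  qed
  then obtain g where g: "x \<longlonglongrightarrow> g"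
    using Cauchy_convergent convergent_def by blast
  have gS: "g \<in> S" using closed_sequentially[OF S(2) _ g] x(1) by blast
  have "q g \<le> d + 0"
  proof (rule LIMSEQ_le)
    show "(\<lambda>n. q (x n)) \<longlonglongrightarrow> q g" unfolding q_def by (intro tendsto_intros g)
    show "(\<lambda>n. d + 1 / real (Suc n)) \<longlonglongrightarrow> d + 0"
      by (intro tendsto_add tendsto_const LIMSEQ_Suc lim_1_over_n)
    show "\<exists>N. \<forall>n\<ge>N. q (x n) \<le> d + 1 / real (Suc n)" using x(2) less_imp_le by blast
  qed
  then have qg: "q g \<le> d" by simp
  have "inner (f - g) h = 0" if h: "h \<in> S" for h
  proof (cases "h = 0")
    case False
    define a where "a = inner (f - g) h"
    define t where "t = a / inner h h"
    have hh: "inner h h > 0" using False by simp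
    have "g + t *\<^sub>R h \<in> S" using S(1) gS h by (intro subspace_scale subspace_add)
    then have "q g \<le> q (g + t *\<^sub>R h)" using d_le qg by fastforce
    also have "\<dots> = q g - 2 * t * a + t * t * inner h h"
      unfolding q_def power2_norm_eq_inner a_def
      by (simp add: algebra_simps inner_commute)
    also have "t * t * inner h h = t * a" using hh by (simp add: t_def)
    finally have "t * a \<le> 0" by linarith
    then have "a * a \<le> 0" using hh by (simp add: t_def divide_le_0_iff)
    then show ?thesis by (metis a_def mult_eq_0_iff not_square_less_zero order_antisym_conv linorder_le_less_linear)
  qed simp
  then show ?thesis using gS by blast
qed

theorem riesz_representation_on_subspace:
  fixes S :: "'a::{real_inner,complete_space} set" and l :: "'a \<Rightarrow> real"
  assumes S: "subspace S" "closed S"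
    and add: "\<And>x y. x \<in> S \<Longrightarrow> y \<in> S \<Longrightarrow> l (x + y) = l x + l y"
    and scale: "\<And>c x. x \<in> S \<Longrightarrow> l (c *\<^sub>R x) = c * l x"
    and bound: "\<And>x. x \<in> S \<Longrightarrow> \<bar>l x\<bar> \<le> C * norm x"
  shows "\<exists>w\<in>S. \<forall>x\<in>S. l x = inner x w"
proof -
  have diff: "l (x - y) = l x - l y" if "x \<in> S" "y \<in> S" for x y
  proof -
    have "-1 *\<^sub>R y \<in> S" using S(1) that subspace_scale by blast
    then have "l (x + (-1) *\<^sub>R y) = l x - l y"
      using add[OF that(1), of "-1 *\<^sub>R y"] scale[OF that(2), of "-1"] by simp
    then show ?thesis by simp
  qed
  define N where "N = {x \<in> S. l x = 0}"
  have N: "subspace N"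
    using S(1) scale[of 0 0] by (auto simp: N_def subspace_def add scale)
  have "closed N"
    unfolding closed_sequential_limits
  proof (intro allI impI, elim conjE)
    fix x a assume x: "\<forall>n. x n \<in> N" and lim: "x \<longlonglongrightarrow> a"
    have aS: "a \<in> S" using closed_sequentially[OF S(2) _ lim] x by (auto simp: N_def)
    have b: "\<bar>l a\<bar> \<le> C * norm (a - x n)" for n
      using bound[of "a - x n"] diff[of a "x n"] x aS S(1) by (auto simp: N_def subspace_diff)
    have "(\<lambda>n. C * norm (a - x n)) \<longlonglongrightarrow> C * norm (a - a)" by (intro tendsto_intros lim)
    then have "\<bar>l a\<bar> \<le> 0" using b by (intro LIMSEQ_le_const) auto
    then show "a \<in> N" using aS by (simp add: N_def)
  qed
  show ?thesis
  proof (cases "\<forall>x\<in>S. l x = 0")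
    case True
    then show ?thesis using subspace_0[OF S(1)] by (intro bexI[of _ 0]) auto
  next
    case False
    then obtain f where f: "f \<in> S" "l f \<noteq> 0" by blast
    obtain p where p: "p \<in> N" "\<And>h. h \<in> N \<Longrightarrow> inner (f - p) h = 0"
      using orthogonal_projection_exists[OF N \<open>closed N\<close>] by blast
    \<comment> \<open>The vector \<open>g\<close> spans the orthogonal complement of the kernel in \<open>S\<close>.\<close>
    define g where "g = f - p"
    have gS: "g \<in> S" using f p S(1) by (simp add: g_def N_def subspace_diff)
    have lg: "l g = l f" using diff[of f p] f p by (simp add: g_def N_def)
    have gg: "inner g g \<noteq> 0" using lg f p(1) scale[OF f(1), of 0] by (auto simp: g_def N_def)
    have "l x = inner x ((l g / inner g g) *\<^sub>R g)" if "x \<in> S" for x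
    proof -
      have m: "(l x / l g) *\<^sub>R g \<in> S" using S(1) gS subspace_scale by blast
      have "x - (l x / l g) *\<^sub>R g \<in> N"
        using diff[OF that m] scale[OF gS] lg f that m S(1) by (simp add: N_def subspace_diff)
      then have "inner g (x - (l x / l g) *\<^sub>R g) = 0" unfolding g_def by (rule p(2))
      then have "inner x g = (l x / l g) * inner g g"
        by (simp add: inner_diff_right inner_commute)
      then show ?thesis using gg lg f by simp
    qed
    moreover have "(l g / inner g g) *\<^sub>R g \<in> S" using S(1) gS subspace_scale by blast
    ultimately show ?thesis by blast
  qed
qed

section \<open>Completeness of \<open>L2\<close>\<close>

lemma square_integrable_rep: "square_integrable (rep_L2 f)"
  using Quotient_rep_reflp[OF Quotient_L2, of f] by simp

lemma rep_abs_L2: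
  assumes "square_integrable f"
  shows "AE z in circle_measure. rep_L2 (abs_L2 f) z = f z"
proof -
  have "square_integrable (rep_L2 (abs_L2 f)) \<and> square_integrable f
      \<and> (AE z in circle_measure. rep_L2 (abs_L2 f) z = f z)"
    by (rule Quotient_rep_abs[OF Quotient_L2]) (simp add: assms)
  then show ?thesis by blast
qed

lemma abs_L2_cong:
  assumes "square_integrable f" "square_integrable g" "AE z in circle_measure. f z = g z"
  shows "abs_L2 f = abs_L2 g"
  using assms by (intro Quotient_rel_abs[OF Quotient_L2]) simp

lemma abs_rep_L2 [simp]: "abs_L2 (rep_L2 f) = f"
  by (rule Quotient_abs_rep[OF Quotient_L2])

lemma cinner_abs_L2:
  assumes "square_integrable f" "square_integrable g"
  shows "cinner (abs_L2 f) (abs_L2 g) = (LINT z|circle_measure. f z * cnj (g z))"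
  using assms by (simp add: cinner.abs_eq eq_onp_def)

lemma plus_abs_L2:
  assumes "square_integrable f" "square_integrable g"
  shows "abs_L2 f + abs_L2 g = abs_L2 (\<lambda>z. f z + g z)"
  using assms by (simp add: plus_L2.abs_eq)

lemma scaleC_abs_L2:
  assumes "square_integrable f"
  shows "scaleC c (abs_L2 f) = abs_L2 (\<lambda>z. c * f z)"
  using assms by (simp add: scaleC.abs_eq)

lemma minus_abs_L2:
  assumes "square_integrable f" "square_integrable g"
  shows "abs_L2 f - abs_L2 g = abs_L2 (\<lambda>z. f z - g z)"
  using assms square_integrable_scale[of g "-1"]
  by (simp add: minus_L2_def uminus_L2.abs_eq plus_abs_L2)

lemma norm_L2_eq_nn_integral:
  "ennreal ((norm (f - g))\<^sup>2) = (\<integral>\<^sup>+z. ennreal ((norm (rep_L2 f z - rep_L2 g z))\<^sup>2) \<partial>circle_measure)"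
proof -
  let ?h = "\<lambda>z. rep_L2 f z - rep_L2 g z"
  have sq: "square_integrable ?h"
    using square_integrable_add[OF square_integrable_rep[of f] square_integrable_scale[OF square_integrable_rep[of g], of "-1"]]
    by simp
  have "f - g = abs_L2 ?h"
    using minus_abs_L2[OF square_integrable_rep[of f] square_integrable_rep[of g]] by simp
  then have "complex_of_real ((norm (f - g))\<^sup>2) = (LINT z|circle_measure. ?h z * cnj (?h z))"
    using sq by (simp only: cinner_self[symmetric] cinner_abs_L2)
  then have "(norm (f - g))\<^sup>2 = (LINT z|circle_measure. (norm (?h z))\<^sup>2)"
    by (simp only: integral_mult_cnj_self of_real_eq_iff)
  then show ?thesis
    using sq by (simp add: square_integrable_def nn_integral_eq_integral)
qed

text \<open>
  This is the theorem of Riesz and Fischer. A Cauchy sequence has a subsequence \<open>x\<close> with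
  \<open>\<parallel>x (n+1) - x n\<parallel>\<^sup>2 < 4\<^sup>-\<^sup>n\<close>. By \<open>2 d \<le> 2\<^sup>n d\<^sup>2 + 2\<^sup>-\<^sup>n\<close> the increments are almost everywhere
  summable, so the subsequence converges pointwise, and Fatou's lemma turns the pointwise limit
  into a limit in norm.
\<close>
instance L2 :: complete_space
proof
  fix X :: "nat \<Rightarrow> L2" assume "Cauchy X"
  then have "\<exists>N. \<forall>m\<ge>N. \<forall>n\<ge>N. norm (X m - X n) < (1/2) ^ j" for j :: nat
    using metric_CauchyD[of X "(1/2) ^ j"] by (simp add: dist_norm)
  then obtain N where N: "\<And>j m n. m \<ge> N j \<Longrightarrow> n \<ge> N j \<Longrightarrow> norm (X m - X n) < (1/2) ^ j"
    by metis
  define K where "K n = (\<Sum>i\<le>n. N i)" for n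
  have K_ge: "K n \<ge> N j" if "j \<le> n" for n j
    unfolding K_def using that by (intro member_le_sum) auto
  define f where "f n = rep_L2 (X (K n))" for n
  have [measurable]: "rep_L2 h \<in> borel_measurable circle_measure" for h
    using square_integrable_rep square_integrable_measurable by blast
  have [measurable]: "f n \<in> borel_measurable circle_measure" for n
    by (simp add: f_def)
  define d where "d n z = norm (f (Suc n) z - f n z)" for n z
  have [measurable]: "d n \<in> borel_measurable circle_measure" for n
    unfolding d_def by measurable
  have "(\<integral>\<^sup>+z. (\<Sum>n. ennreal (2^n * (d n z)\<^sup>2)) \<partial>circle_measure)
      = (\<Sum>n. \<integral>\<^sup>+z. ennreal (2^n * (d n z)\<^sup>2) \<partial>circle_measure)"
    by (rule nn_integral_suminf) simp
  also have "\<dots> \<le> (\<Sum>n. ennreal ((1/2)^n))"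
  proof (rule suminf_le)
    fix n
    have "(\<integral>\<^sup>+z. ennreal (2^n * (d n z)\<^sup>2) \<partial>circle_measure)
        = ennreal (2^n) * ennreal ((norm (X (K (Suc n)) - X (K n)))\<^sup>2)"
      unfolding norm_L2_eq_nn_integral
      by (subst nn_integral_cmult[symmetric]) (auto simp: d_def f_def ennreal_mult)
    also have "\<dots> = ennreal (2^n * (norm (X (K (Suc n)) - X (K n)))\<^sup>2)"
      by (simp add: ennreal_mult)
    also have "\<dots> \<le> ennreal ((1/2)^n)"
    proof (rule ennreal_leI)
      have "norm (X (K (Suc n)) - X (K n)) \<le> (1/2)^n"
        using N[OF K_ge K_ge, of n "Suc n" n] by simp
      then have "(norm (X (K (Suc n)) - X (K n)))\<^sup>2 \<le> ((1/2)^n)\<^sup>2"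
        by (rule power_mono) simp
      then have "2^n * (norm (X (K (Suc n)) - X (K n)))\<^sup>2 \<le> 2^n * ((1/2)^n)\<^sup>2"
        by (rule mult_left_mono) simp
      also have "\<dots> = (1/2)^n" by (simp add: power2_eq_square power_one_over)
      finally show "2^n * (norm (X (K (Suc n)) - X (K n)))\<^sup>2 \<le> (1/2)^n" .
    qed
    finally show "(\<integral>\<^sup>+z. ennreal (2^n * (d n z)\<^sup>2) \<partial>circle_measure) \<le> ennreal ((1/2)^n)" .
  qed auto
  also have "\<dots> = ennreal (\<Sum>n. (1/2)^n)"
    by (rule suminf_ennreal2) (auto intro: summable_geometric)
  also have "\<dots> < \<infinity>"
    unfolding infinity_ennreal_def by (rule ennreal_less_top)
  finally have "AE z in circle_measure. (\<Sum>n. ennreal (2^n * (d n z)\<^sup>2)) \<noteq> \<infinity>"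
    by (intro nn_integral_PInf_AE) auto
  then have conv: "AE z in circle_measure. convergent (\<lambda>n. f n z)"
  proof eventually_elim
    case (elim z)
    then have "summable (\<lambda>n. 2^n * (d n z)\<^sup>2)"
      by (intro summable_suminf_not_top) auto
    then have "summable (\<lambda>n. 2^n * (d n z)\<^sup>2 + (1/2)^n)"
      by (intro summable_add) (auto simp: summable_geometric)
    then have "summable (\<lambda>n. f (Suc n) z - f n z)"
    proof (rule summable_comparison_test')
      fix n :: nat
      have "0 \<le> 2^n * (d n z - (1/2)^n)\<^sup>2" by simp
      also have "\<dots> = 2^n * (d n z)\<^sup>2 - 2 * d n z + (1/2)^n"
        by (simp add: power2_diff power_one_over) (simp add: field_simps power2_eq_square)
      finally have "2 * d n z \<le> 2^n * (d n z)\<^sup>2 + (1/2)^n" by simp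
      moreover have "0 \<le> d n z" by (simp add: d_def)
      ultimately have "d n z \<le> 2^n * (d n z)\<^sup>2 + (1/2)^n" by linarith
      then show "norm (f (Suc n) z - f n z) \<le> 2^n * (d n z)\<^sup>2 + (1/2)^n"
        by (simp add: d_def)
    qed
    then have "(\<lambda>n. (\<Sum>i<n. f (Suc i) z - f i z) + f 0 z) \<longlonglongrightarrow> (\<Sum>i. f (Suc i) z - f i z) + f 0 z"
      by (intro tendsto_add tendsto_const summable_LIMSEQ)
    moreover have "(\<Sum>i<n. f (Suc i) z - f i z) + f 0 z = f n z" for n
      using sum_lessThan_telescope[of "\<lambda>i. f i z" n] by simp
    ultimately show ?case unfolding convergent_def by simp blast
  qed
  define g where "g z = lim (\<lambda>n. f n z)" for z
  have g [measurable]: "g \<in> borel_measurable circle_measure"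
    unfolding g_def by (rule borel_measurable_lim_metric) simp
  have fatou: "(\<integral>\<^sup>+z. ennreal ((norm (g z - rep_L2 (X m) z))\<^sup>2) \<partial>circle_measure)
      \<le> ennreal (((1/2)^j)\<^sup>2)" if m: "m \<ge> N j" for m j
  proof -
    have "(\<integral>\<^sup>+z. ennreal ((norm (g z - rep_L2 (X m) z))\<^sup>2) \<partial>circle_measure)
        = (\<integral>\<^sup>+z. liminf (\<lambda>n. ennreal ((norm (f n z - rep_L2 (X m) z))\<^sup>2)) \<partial>circle_measure)"
    proof (rule nn_integral_cong_AE, use conv in eventually_elim)
      case (elim z)
      then have "(\<lambda>n. f n z) \<longlonglongrightarrow> g z" by (simp add: g_def convergent_LIMSEQ_iff)
      then have "(\<lambda>n. ennreal ((norm (f n z - rep_L2 (X m) z))\<^sup>2))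
          \<longlonglongrightarrow> ennreal ((norm (g z - rep_L2 (X m) z))\<^sup>2)"
        by (intro tendsto_intros)
      then show ?case using lim_imp_Liminf[OF sequentially_bot] by metis
    qed
    also have "\<dots> \<le> liminf (\<lambda>n. \<integral>\<^sup>+z. ennreal ((norm (f n z - rep_L2 (X m) z))\<^sup>2) \<partial>circle_measure)"
      by (rule nn_integral_liminf) simp
    also have "\<dots> = liminf (\<lambda>n. ennreal ((norm (X (K n) - X m))\<^sup>2))"
      by (simp only: f_def norm_L2_eq_nn_integral)
    also have "\<dots> \<le> limsup (\<lambda>n. ennreal ((norm (X (K n) - X m))\<^sup>2))"
      by (rule Liminf_le_Limsup) simp
    also have "\<dots> \<le> ennreal (((1/2)^j)\<^sup>2)"
    proof (rule Limsup_bounded)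
      show "\<forall>\<^sub>F n in sequentially. ennreal ((norm (X (K n) - X m))\<^sup>2) \<le> ennreal (((1/2)^j)\<^sup>2)"
        using eventually_ge_at_top[of j]
      proof eventually_elim
        case (elim n)
        then have "norm (X (K n) - X m) \<le> (1/2)^j"
          using N[OF K_ge[OF elim] m] by simp
        then show ?case by (intro ennreal_leI power_mono) auto
      qed
    qed
    finally show ?thesis .
  qed
  have "square_integrable (\<lambda>z. g z - rep_L2 (X (N 0)) z)"
    unfolding square_integrable_def
  proof
    show "integrable circle_measure (\<lambda>z. (norm (g z - rep_L2 (X (N 0)) z))\<^sup>2)"
    proof (rule integrableI_bounded)
      have "(\<integral>\<^sup>+z. ennreal ((norm (g z - rep_L2 (X (N 0)) z))\<^sup>2) \<partial>circle_measure) < \<infinity>"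
        using fatou[of 0 "N 0"] by (auto intro: le_less_trans)
      then show "(\<integral>\<^sup>+z. ennreal (norm ((norm (g z - rep_L2 (X (N 0)) z))\<^sup>2)) \<partial>circle_measure) < \<infinity>"
        by simp
    qed simp
  qed simp
  from square_integrable_add[OF this square_integrable_rep[of "X (N 0)"]]
  have g_sq: "square_integrable g" by simp
  have lim: "norm (abs_L2 g - X m) \<le> (1/2)^j" if m: "m \<ge> N j" for m j
  proof -
    have "ennreal ((norm (abs_L2 g - X m))\<^sup>2)
        = (\<integral>\<^sup>+z. ennreal ((norm (g z - rep_L2 (X m) z))\<^sup>2) \<partial>circle_measure)"
      unfolding norm_L2_eq_nn_integral
      by (rule nn_integral_cong_AE) (use rep_abs_L2[OF g_sq] in eventually_elim, simp)
    then have "ennreal ((norm (abs_L2 g - X m))\<^sup>2) \<le> ennreal (((1/2)^j)\<^sup>2)"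
      using fatou[OF m] by simp
    then have "(norm (abs_L2 g - X m))\<^sup>2 \<le> ((1/2)^j)\<^sup>2" by simp
    then show ?thesis by (rule power2_le_imp_le) simp
  qed
  have "X \<longlonglongrightarrow> abs_L2 g"
  proof (rule metric_LIMSEQ_I)
    fix e :: real assume "e > 0"
    then obtain j where j: "(1/2::real)^j < e" using real_arch_pow_inv[of e "1/2"] by auto
    show "\<exists>M. \<forall>m\<ge>M. dist (X m) (abs_L2 g) < e"
    proof (intro exI allI impI)
      fix m assume "m \<ge> N j"
      from lim[OF this] j show "dist (X m) (abs_L2 g) < e"
        by (simp add: dist_norm norm_minus_commute)
    qed
  qed
  then show "convergent X" by (auto simp: convergent_def)
qed

section \<open>The complex inner product\<close>

lemma scaleC_add_right: "scaleC c (f + g) = scaleC c f + scaleC c g"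
  by transfer (auto intro!: square_integrable_add square_integrable_scale simp: algebra_simps)

lemma scaleR_eq_scaleC: "r *\<^sub>R f = scaleC (complex_of_real r) f"
  by transfer (auto intro!: square_integrable_scale)

lemma scaleC_zero_left [simp]: "scaleC 0 f = 0"
  using scaleR_eq_scaleC[of 0 f] by simp

lemma scaleC_minus_one: "scaleC (-1) f = - f"
  using scaleR_eq_scaleC[of "-1" f] by simp

lemma scaleC_zero_right [simp]: "scaleC c 0 = 0"
  using scaleC_add_right[of c 0 0] by simp

lemma scaleC_diff_right: "scaleC c (f - g) = scaleC c f - scaleC c g"
proof -
  have "scaleC c (f - g) + scaleC c g = scaleC c f"
    unfolding scaleC_add_right[symmetric] by simp
  then show ?thesis by (simp add: algebra_simps)
qed

lemma cinner_add_left: "cinner (f + g) h = cinner f h + cinner g h"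
  by transfer (simp add: ring_distribs integrable_mult_cnj)

lemma cinner_scaleC_left: "cinner (scaleC c f) g = c * cinner f g"
  by transfer (simp add: mult.assoc)

lemma cinner_commute: "cinner f g = cnj (cinner g f)"
proof transfer
  fix f g :: "complex \<Rightarrow> complex"
  show "(LINT z|circle_measure. f z * cnj (g z)) = cnj (LINT z|circle_measure. g z * cnj (f z))"
    by (subst Bochner_Integration.integral_cnj[symmetric]) (simp add: mult.commute)
qed

lemma cinner_add_right: "cinner f (g + h) = cinner f g + cinner f h"
  using cinner_commute[of f] by (simp add: cinner_add_left)

lemma cinner_scaleC_right: "cinner f (scaleC c g) = cnj c * cinner f g"
  using cinner_commute[of f] by (simp add: cinner_scaleC_left)

lemma cinner_diff_left: "cinner (f - g) h = cinner f h - cinner g h"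
  using cinner_add_left[of "f - g" g h] by simp

lemma cinner_diff_right: "cinner f (g - h) = cinner f g - cinner f h"
  using cinner_add_right[of f "g - h" h] by simp

lemma cinner_zero_left [simp]: "cinner 0 f = 0"
  using cinner_diff_left[of 0 0 f] by simp

lemma cinner_zero_right [simp]: "cinner f 0 = 0"
  using cinner_diff_right[of f 0 0] by simp

lemma cinner_eq_zero_commute: "cinner f g = 0 \<longleftrightarrow> cinner g f = 0"
  using cinner_commute[of f g] by simp

lemma cinner_self_eq_zero [simp]: "cinner f f = 0 \<longleftrightarrow> f = 0"
  by (simp add: cinner_self)

lemma cinner_eq_Complex: "cinner f g = Complex (inner f g) (inner f (scaleC \<i> g))"
  by (simp add: complex_eq_iff inner_eq_Re_cinner cinner_scaleC_right)

lemma tendsto_cinner [tendsto_intros]: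
  assumes "(f \<longlongrightarrow> a) F"
  shows "((\<lambda>x. cinner (f x) g) \<longlongrightarrow> cinner a g) F"
  unfolding cinner_eq_Complex by (intro tendsto_intros assms)

definition closed_csubspace :: "L2 set \<Rightarrow> bool" where
  "closed_csubspace M \<longleftrightarrow> 0 \<in> M \<and> (\<forall>f\<in>M. \<forall>g\<in>M. f + g \<in> M) \<and> (\<forall>c. \<forall>f\<in>M. scaleC c f \<in> M) \<and> closed M"

lemma closed_csubspaceD:
  assumes "closed_csubspace M"
  shows "0 \<in> M" "f \<in> M \<Longrightarrow> g \<in> M \<Longrightarrow> f + g \<in> M" "f \<in> M \<Longrightarrow> scaleC c f \<in> M"
    "f \<in> M \<Longrightarrow> g \<in> M \<Longrightarrow> f - g \<in> M" "closed M" "subspace M"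
proof -
  show 1: "0 \<in> M" "f \<in> M \<Longrightarrow> g \<in> M \<Longrightarrow> f + g \<in> M" "f \<in> M \<Longrightarrow> scaleC c f \<in> M" "closed M" for f g c
    using assms by (auto simp: closed_csubspace_def)
  show "f \<in> M \<Longrightarrow> g \<in> M \<Longrightarrow> f - g \<in> M"
    using 1(2)[of f "- g"] 1(3)[of g "-1"] by (simp add: scaleC_minus_one)
  show "subspace M" unfolding subspace_def by (auto simp: 1 scaleR_eq_scaleC)
qed

text \<open>
  A complex subspace is invariant under multiplication by \<open>\<i>\<close>, hence orthogonality to it is
  the same for the real and for the complex inner product.
\<close>

lemma orthogonal_complex_of_real:
  assumes "closed_csubspace M" "\<forall>h\<in>M. inner f h = 0" "h \<in> M"
  shows "cinner f h = 0"
  using assms closed_csubspaceD(3)[OF assms(1,3), of \<i>] by (simp add: cinner_eq_Complex complex_eq_iff)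

lemma orthogonal_proj_eqI:
  assumes "closed_csubspace M" "g \<in> M" "\<And>h. h \<in> M \<Longrightarrow> cinner (f - g) h = 0"
  shows "orthogonal_proj M f = g"
  unfolding orthogonal_proj_def
proof (rule the_equality)
  fix g' assume g': "g' \<in> M \<and> (\<forall>h\<in>M. cinner (f - g') h = 0)"
  have m: "g - g' \<in> M" using closed_csubspaceD(4)[OF assms(1)] assms(2) g' by blast
  have "cinner (g - g') (g - g') = cinner (f - g') (g - g') - cinner (f - g) (g - g')"
    by (simp add: cinner_diff_left)
  also have "\<dots> = 0" using g' assms(3)[OF m] m by simp
  finally show "g' = g" by simp
qed (use assms in auto)

lemma orthogonal_proj:
  assumes "closed_csubspace M"
  shows "orthogonal_proj M f \<in> M" "h \<in> M \<Longrightarrow> cinner (f - orthogonal_proj M f) h = 0"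
proof -
  obtain g where g: "g \<in> M" "\<forall>h\<in>M. inner (f - g) h = 0"
    using orthogonal_projection_exists closed_csubspaceD(5,6)[OF assms] by blast
  then have "orthogonal_proj M f = g"
    using orthogonal_complex_of_real[OF assms] by (intro orthogonal_proj_eqI[OF assms]) auto
  with g show "orthogonal_proj M f \<in> M" "h \<in> M \<Longrightarrow> cinner (f - orthogonal_proj M f) h = 0"
    using orthogonal_complex_of_real[OF assms] by auto
qed

lemma bounded_operator_onD:
  assumes "bounded_operator_on M A"
  shows "f \<in> M \<Longrightarrow> A f \<in> M" "f \<in> M \<Longrightarrow> g \<in> M \<Longrightarrow> A (f + g) = A f + A g"
    "f \<in> M \<Longrightarrow> A (scaleC c f) = scaleC c (A f)"
  using assms by (auto simp: bounded_operator_on_def)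

lemma adjoint_on_eqI:
  assumes "closed_csubspace M" "w \<in> M" "\<And>f. f \<in> M \<Longrightarrow> cinner (A f) g = cinner f w"
  shows "adjoint_on M A g = w"
  unfolding adjoint_on_def
proof (rule the_equality)
  fix w' assume w': "w' \<in> M \<and> (\<forall>f\<in>M. cinner (A f) g = cinner f w')"
  have m: "w' - w \<in> M" using closed_csubspaceD(4)[OF assms(1)] assms(2) w' by blast
  have "cinner (w' - w) (w' - w) = 0"
    using w' assms(3)[OF m] m by (simp add: cinner_diff_right)
  then show "w' = w" by simp
qed (use assms in auto)

text \<open>
  The adjoint is a definite description, so that it says something only once a representing
  vector is known to exist. That vector comes from the Riesz theorem for the real part of the
  functional, from which the imaginary part is recovered by complex linearity.
\<close>

theorem adjoint_on_cinner:
  assumes M: "closed_csubspace M" and A: "bounded_operator_on M A" and f: "f \<in> M"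
  shows "cinner (A f) g = cinner f (adjoint_on M A g)"
proof -
  note MD = closed_csubspaceD[OF M] and AD = bounded_operator_onD[OF A]
  obtain C where C: "\<And>f. f \<in> M \<Longrightarrow> norm (A f) \<le> C * norm f"
    using A unfolding bounded_operator_on_def by blast
  have "\<exists>w\<in>M. \<forall>x\<in>M. inner (A x) g = inner x w"
  proof (rule riesz_representation_on_subspace[OF MD(6,5), where C = "C * norm g"])
    show "inner (A (x + y)) g = inner (A x) g + inner (A y) g" if "x \<in> M" "y \<in> M" for x y
      using that by (simp add: AD inner_add_left)
    show "inner (A (c *\<^sub>R x)) g = c * inner (A x) g" if "x \<in> M" for c x
      using that AD(3)[of x "complex_of_real c"] by (simp flip: scaleR_eq_scaleC)
    show "\<bar>inner (A x) g\<bar> \<le> C * norm g * norm x" if "x \<in> M" for x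
    proof -
      have "\<bar>inner (A x) g\<bar> \<le> norm (A x) * norm g" by (rule Cauchy_Schwarz_ineq2)
      also have "\<dots> \<le> (C * norm x) * norm g" by (rule mult_right_mono[OF C[OF that]]) simp
      finally show ?thesis by (simp add: mult_ac)
    qed
  qed
  then obtain w where w: "w \<in> M" "\<And>x. x \<in> M \<Longrightarrow> inner (A x) g = inner x w" by blast
  have "cinner (A x) g = cinner x w" if x: "x \<in> M" for x
  proof -
    have "Re (cinner (A x) g) = Re (cinner x w)"
      using w(2)[OF x] by (simp add: inner_eq_Re_cinner)
    moreover have "Re (\<i> * cinner (A x) g) = Re (\<i> * cinner x w)"
      using w(2)[OF MD(3)[OF x, of \<i>]] x
      by (simp add: AD inner_eq_Re_cinner cinner_scaleC_left)
    ultimately show ?thesis by (simp add: complex_eq_iff)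
  qed
  with adjoint_on_eqI[OF M w(1)] f show ?thesis by metis
qed

section \<open>Multiplication operators and the flip\<close>

lemma L2_cases:
  obtains f where "h = abs_L2 f" "square_integrable f"
  using abs_rep_L2 square_integrable_rep by metis

lemma Linf_measurable [measurable_dest]: "\<phi> \<in> Linf \<Longrightarrow> \<phi> \<in> borel_measurable circle_measure"
  by (simp add: Linf_def)

lemma LinfI:
  assumes "\<phi> \<in> borel_measurable circle_measure" "AE z in circle_measure. norm (\<phi> z) \<le> C"
  shows "\<phi> \<in> Linf"
  using assms by (auto simp: Linf_def)

lemma LinfE:
  assumes "\<phi> \<in> Linf"
  obtains C where "AE z in circle_measure. norm (\<phi> z) \<le> C"
  using assms by (auto simp: Linf_def)

lemma Linf_const: "(\<lambda>z. c) \<in> Linf"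
  by (rule LinfI[of _ "norm c"]) auto

lemma Linf_ident: "(\<lambda>z. z) \<in> Linf"
  by (rule LinfI[of _ 1]) (use AE_circle_measure_norm in auto)

lemma Linf_mult:
  assumes "\<phi> \<in> Linf" "\<psi> \<in> Linf"
  shows "(\<lambda>z. \<phi> z * \<psi> z) \<in> Linf"
proof -
  note [measurable] = assms[THEN Linf_measurable]
  obtain C where C: "AE z in circle_measure. norm (\<phi> z) \<le> C" using assms(1) by (rule LinfE)
  obtain D where D: "AE z in circle_measure. norm (\<psi> z) \<le> D" using assms(2) by (rule LinfE)
  have "AE z in circle_measure. norm (\<phi> z * \<psi> z) \<le> C * D"
    using C D
  proof eventually_elim
    case (elim z)
    have "0 \<le> C" using elim(1) norm_ge_zero order_trans by blast
    then show ?case unfolding norm_mult using elim by (intro mult_mono) auto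
  qed
  then show ?thesis by (intro LinfI) auto
qed

lemma Linf_diff:
  assumes "\<phi> \<in> Linf" "\<psi> \<in> Linf"
  shows "(\<lambda>z. \<phi> z - \<psi> z) \<in> Linf"
proof -
  note [measurable] = assms[THEN Linf_measurable]
  obtain C where C: "AE z in circle_measure. norm (\<phi> z) \<le> C" using assms(1) by (rule LinfE)
  obtain D where D: "AE z in circle_measure. norm (\<psi> z) \<le> D" using assms(2) by (rule LinfE)
  have "AE z in circle_measure. norm (\<phi> z - \<psi> z) \<le> C + D"
    using C D
  proof eventually_elim
    case (elim z)
    then show ?case using norm_triangle_ineq4[of "\<phi> z" "\<psi> z"] by linarith
  qed
  then show ?thesis by (intro LinfI) auto
qed

lemma Linf_cnj:
  assumes "\<phi> \<in> Linf"
  shows "(\<lambda>z. cnj (\<phi> z)) \<in> Linf"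
proof -
  note [measurable] = assms[THEN Linf_measurable]
  obtain C where "AE z in circle_measure. norm (\<phi> z) \<le> C" using assms by (rule LinfE)
  then show ?thesis by (intro LinfI) auto
qed

lemma AE_circle_measure_cnj:
  assumes "AE z in circle_measure. P z"
  shows "AE z in circle_measure. P (cnj z)"
proof (rule AE_distrD[where f = cnj and M' = borel])
  show "cnj \<in> measurable circle_measure (borel :: complex measure)" by simp
  show "AE z in distr circle_measure borel cnj. P z"
    using assms by (simp only: distr_circle_measure_cnj)
qed

lemma Linf_comp_cnj:
  assumes "\<phi> \<in> Linf"
  shows "(\<lambda>z. \<phi> (cnj z)) \<in> Linf"
proof -
  have [measurable]: "\<phi> \<in> borel_measurable borel"
    using Linf_measurable[OF assms] by (simp cong: measurable_cong_sets)
  obtain C where "AE z in circle_measure. norm (\<phi> z) \<le> C" using assms by (rule LinfE)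
  from AE_circle_measure_cnj[OF this] show ?thesis by (intro LinfI) auto
qed

lemma star_Linf: "\<phi> \<in> Linf \<Longrightarrow> star \<phi> \<in> Linf"
  unfolding star_def[abs_def] by (intro Linf_cnj Linf_comp_cnj)

lemma square_integrable_mult_Linf:
  assumes "\<phi> \<in> Linf" "square_integrable f"
  shows "square_integrable (\<lambda>z. \<phi> z * f z)"
proof -
  obtain C where "AE z in circle_measure. norm (\<phi> z) \<le> C" using assms(1) by (rule LinfE)
  then show ?thesis by (rule square_integrable_bounded_mult[OF assms(2) Linf_measurable[OF assms(1)]])
qed

interpretation circle: finite_measure circle_measure
  by standard (simp add: emeasure_circle_measure_UNIV)

lemma square_integrable_Linf:
  assumes "\<phi> \<in> Linf"
  shows "square_integrable \<phi>"
  using square_integrable_mult_Linf[OF assms, of "\<lambda>z. 1"] by (simp add: square_integrable_def)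

lemma mult_op_cong:
  assumes "\<phi> \<in> Linf" "\<psi> \<in> Linf" "AE z in circle_measure. \<phi> z = \<psi> z"
  shows "mult_op \<phi> h = mult_op \<psi> h"
  unfolding mult_op_def using assms(3)
  by (intro abs_L2_cong square_integrable_mult_Linf assms square_integrable_rep) auto

lemma mult_op_add: "\<phi> \<in> Linf \<Longrightarrow> mult_op \<phi> (g + h) = mult_op \<phi> g + mult_op \<phi> h"
  by (cases g rule: L2_cases; cases h rule: L2_cases)
    (simp add: mult_op_abs_L2 plus_abs_L2 square_integrable_mult_Linf square_integrable_add distrib_left)

lemma mult_op_scaleC: "\<phi> \<in> Linf \<Longrightarrow> mult_op \<phi> (scaleC c h) = scaleC c (mult_op \<phi> h)"
  by (cases h rule: L2_cases)
    (simp add: mult_op_abs_L2 scaleC_abs_L2 square_integrable_mult_Linf square_integrable_scale mult.left_commute)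

lemma mult_op_diff: "\<phi> \<in> Linf \<Longrightarrow> mult_op \<phi> (g - h) = mult_op \<phi> g - mult_op \<phi> h"
  using mult_op_add[of \<phi> "g - h" h] by simp

lemma mult_op_mult_op:
  assumes "\<phi> \<in> Linf" "\<psi> \<in> Linf"
  shows "mult_op \<phi> (mult_op \<psi> h) = mult_op (\<lambda>z. \<phi> z * \<psi> z) h"
  using assms by (cases h rule: L2_cases)
    (simp add: mult_op_abs_L2 square_integrable_mult_Linf Linf_mult mult.assoc)

lemma mult_op_commute:
  assumes "\<phi> \<in> Linf" "\<psi> \<in> Linf"
  shows "mult_op \<phi> (mult_op \<psi> h) = mult_op \<psi> (mult_op \<phi> h)"
  using assms by (simp add: mult_op_mult_op mult_ac)

lemma cinner_mult_op:
  assumes "\<phi> \<in> Linf"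
  shows "cinner (mult_op \<phi> f) g = cinner f (mult_op (\<lambda>z. cnj (\<phi> z)) g)"
  using assms by (cases f rule: L2_cases; cases g rule: L2_cases)
    (simp add: mult_op_abs_L2 cinner_abs_L2 square_integrable_mult_Linf Linf_cnj mult.assoc mult.left_commute)

lemma mult_op_one:
  assumes "\<phi> \<in> Linf" "AE z in circle_measure. \<phi> z = 1"
  shows "mult_op \<phi> h = h"
proof -
  have "mult_op \<phi> h = mult_op (\<lambda>z. 1) h" by (intro mult_op_cong Linf_const assms)
  then show ?thesis by (simp add: mult_op_def)
qed

lemma mult_op_cnj_cancel:
  assumes "\<phi> \<in> Linf" "AE z in circle_measure. norm (\<phi> z) = 1"
  shows "mult_op (\<lambda>z. cnj (\<phi> z)) (mult_op \<phi> h) = h" "mult_op \<phi> (mult_op (\<lambda>z. cnj (\<phi> z)) h) = h"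
proof -
  have 1: "AE z in circle_measure. \<phi> z * cnj (\<phi> z) = 1"
    using assms(2) by eventually_elim (simp add: complex_norm_square[symmetric])
  show "mult_op \<phi> (mult_op (\<lambda>z. cnj (\<phi> z)) h) = h"
    using assms(1) 1 by (simp add: mult_op_mult_op Linf_cnj mult_op_one Linf_mult)
  then show "mult_op (\<lambda>z. cnj (\<phi> z)) (mult_op \<phi> h) = h"
    using mult_op_commute[OF assms(1) Linf_cnj[OF assms(1)]] by simp
qed

lemma norm_mult_op_le:
  assumes "\<phi> \<in> Linf"
  shows "\<exists>C. \<forall>h. norm (mult_op \<phi> h) \<le> C * norm h"
proof -
  obtain C where C: "AE z in circle_measure. norm (\<phi> z) \<le> C" using assms by (rule LinfE)
  have "norm (mult_op \<phi> h) \<le> \<bar>C\<bar> * norm h" for h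
  proof -
    obtain f where h: "h = abs_L2 f" and f: "square_integrable f" by (rule L2_cases)
    have n: "(norm (abs_L2 g))\<^sup>2 = (LINT z|circle_measure. (norm (g z))\<^sup>2)" if "square_integrable g" for g
    proof -
      have "complex_of_real ((norm (abs_L2 g))\<^sup>2) = complex_of_real (LINT z|circle_measure. (norm (g z))\<^sup>2)"
        using that by (simp only: cinner_self[symmetric] cinner_abs_L2 integral_mult_cnj_self)
      then show ?thesis by (simp only: of_real_eq_iff)
    qed
    have sq: "square_integrable (\<lambda>z. \<phi> z * f z)" by (rule square_integrable_mult_Linf[OF assms f])
    have "(norm (mult_op \<phi> h))\<^sup>2 = (LINT z|circle_measure. (norm (\<phi> z * f z))\<^sup>2)"
      by (simp only: h mult_op_abs_L2[OF assms f] n[OF sq])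
    also have "\<dots> \<le> (LINT z|circle_measure. C\<^sup>2 * (norm (f z))\<^sup>2)"
    proof (rule integral_mono_AE)
      show "AE z in circle_measure. (norm (\<phi> z * f z))\<^sup>2 \<le> C\<^sup>2 * (norm (f z))\<^sup>2"
        using C by eventually_elim (simp add: norm_mult power_mult_distrib mult_right_mono power_mono)
    qed (use sq f in \<open>simp_all add: square_integrable_def\<close>)
    also have "\<dots> = (\<bar>C\<bar> * norm h)\<^sup>2"
      by (simp add: h n[OF f] power_mult_distrib)
    finally show ?thesis by (rule power2_le_imp_le) simp
  qed
  then show ?thesis by blast
qed

lemma flip_abs_L2: "square_integrable f \<Longrightarrow> flip (abs_L2 f) = abs_L2 (\<lambda>z. f (cnj z))"
  by (simp add: flip.abs_eq)

lemma integral_circle_measure_cnj: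
  fixes f :: "complex \<Rightarrow> 'b::{banach, second_countable_topology}"
  assumes "f \<in> borel_measurable circle_measure"
  shows "(LINT z|circle_measure. f (cnj z)) = (LINT z|circle_measure. f z)"
proof -
  have "(LINT z|distr circle_measure borel cnj. f z) = (LINT z|circle_measure. f (cnj z))"
    by (rule integral_distr) (use assms in \<open>simp_all cong: measurable_cong_sets\<close>)
  then show ?thesis by (simp add: distr_circle_measure_cnj)
qed

lemma square_integrable_comp_cnj:
  assumes "square_integrable f"
  shows "square_integrable (\<lambda>z. f (cnj z))"
proof -
  have f: "f \<in> borel_measurable borel"
    using square_integrable_measurable[OF assms] by (simp cong: measurable_cong_sets)
  then have "integrable (distr circle_measure borel cnj) (\<lambda>z. (norm (f z))\<^sup>2)
      = integrable circle_measure (\<lambda>z. (norm (f (cnj z)))\<^sup>2)"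
    by (intro integrable_distr_eq) auto
  then show ?thesis
    using assms f by (simp add: square_integrable_def distr_circle_measure_cnj)
qed

lemma flip_diff: "flip (f - g) = flip f - flip g"
  by (cases f rule: L2_cases; cases g rule: L2_cases)
    (use square_integrable_add[OF _ square_integrable_scale[of _ "-1"]] in
      \<open>simp add: flip_abs_L2 minus_abs_L2 square_integrable_comp_cnj\<close>)

lemma flip_add: "flip (f + g) = flip f + flip g"
  using flip_diff[of "f + g" g] by simp

lemma flip_scaleC: "flip (scaleC c f) = scaleC c (flip f)"
  by (cases f rule: L2_cases)
    (simp add: flip_abs_L2 scaleC_abs_L2 square_integrable_comp_cnj square_integrable_scale)

lemma cinner_flip: "cinner (flip f) g = cinner f (flip g)"
proof -
  obtain f' where f: "f = abs_L2 f'" "square_integrable f'" by (rule L2_cases)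
  obtain g' where g: "g = abs_L2 g'" "square_integrable g'" by (rule L2_cases)
  have [measurable]: "f' \<in> borel_measurable borel" "g' \<in> borel_measurable borel"
    using f(2) g(2) by (simp_all add: square_integrable_def cong: measurable_cong_sets)
  have "(\<lambda>z. f' (cnj z) * cnj (g' z)) \<in> borel_measurable circle_measure" by simp
  then show ?thesis
    using f g integral_circle_measure_cnj[of "\<lambda>z. f' (cnj z) * cnj (g' z)"]
    by (simp add: flip_abs_L2 cinner_abs_L2 square_integrable_comp_cnj)
qed

lemma norm_flip: "norm (flip f) = norm f"
proof -
  have ff: "flip (flip f) = f"
    by (cases f rule: L2_cases) (simp add: flip_abs_L2 square_integrable_comp_cnj)
  have "complex_of_real ((norm (flip f))\<^sup>2) = complex_of_real ((norm f)\<^sup>2)"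
    by (simp only: cinner_self[symmetric] cinner_flip ff)
  then show ?thesis by (simp only: of_real_eq_iff) (simp add: power2_eq_iff_nonneg)
qed

lemma flip_mult_op:
  "\<phi> \<in> Linf \<Longrightarrow> flip (mult_op \<phi> f) = mult_op (\<lambda>z. \<phi> (cnj z)) (flip f)"
  by (cases f rule: L2_cases)
    (simp add: flip_abs_L2 mult_op_abs_L2 square_integrable_comp_cnj square_integrable_mult_Linf Linf_comp_cnj)

section \<open>Fourier coefficients determine an integrable function\<close>

lemma AE_circle_measure_nonzero: "AE z in circle_measure. z \<noteq> 0"
  using AE_circle_measure_norm by eventually_elim auto

lemma AE_circle_measure_cnj_inverse: "AE z in circle_measure. cnj z = inverse z"
  using AE_circle_measure_norm
  by eventually_elim (rule inverse_unique[symmetric], simp add: complex_norm_square[symmetric])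

lemma powi_measurable [measurable]: "(\<lambda>z::complex. z powi n) \<in> borel_measurable borel"
  by (cases "n \<ge> 0") (simp_all add: power_int_def)

lemma Linf_powi: "(\<lambda>z. z powi n) \<in> Linf"
proof (rule LinfI[of _ 1])
  show "AE z in circle_measure. norm (z powi n) \<le> 1"
    using AE_circle_measure_norm by eventually_elim (simp add: norm_power_int)
qed simp

definition vanishing_fourier :: "(complex \<Rightarrow> complex) \<Rightarrow> bool" where
  "vanishing_fourier f \<longleftrightarrow> integrable circle_measure f \<and> (\<forall>n. fourier_coeff f n = 0)"

lemma integrable_Linf_mult:
  assumes "integrable circle_measure f" "\<phi> \<in> Linf"
  shows "integrable circle_measure (\<lambda>z. \<phi> z * f z)"
proof -
  obtain C where C: "AE z in circle_measure. norm (\<phi> z) \<le> C" using assms(2) by (rule LinfE)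
  note [measurable] = borel_measurable_integrable[OF assms(1)] Linf_measurable[OF assms(2)]
  have "integrable circle_measure (\<lambda>z. C *\<^sub>R f z)" using assms(1) by simp
  then show ?thesis
  proof (rule Bochner_Integration.integrable_bound)
    show "AE z in circle_measure. norm (\<phi> z * f z) \<le> norm (C *\<^sub>R f z)"
      using C by eventually_elim (auto simp: norm_mult intro!: mult_right_mono)
  qed simp
qed

lemma vanishing_fourier_add:
  assumes "vanishing_fourier f" "vanishing_fourier g"
  shows "vanishing_fourier (\<lambda>z. f z + g z)"
proof -
  have "integrable circle_measure (\<lambda>z. z powi (- n) * h z)" if "vanishing_fourier h" for h n
    using that Linf_powi by (intro integrable_Linf_mult) (simp_all add: vanishing_fourier_def)
  then show ?thesis
    using assms by (simp add: vanishing_fourier_def fourier_coeff_def ring_distribs mult.commute)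
qed

lemma vanishing_fourier_cmult: "vanishing_fourier f \<Longrightarrow> vanishing_fourier (\<lambda>z. c * f z)"
  by (simp add: vanishing_fourier_def fourier_coeff_def mult.assoc)

lemma vanishing_fourier_powi:
  assumes "vanishing_fourier f" "\<phi> \<in> Linf" "AE z in circle_measure. \<phi> z = z powi m"
  shows "vanishing_fourier (\<lambda>z. \<phi> z * f z)"
  unfolding vanishing_fourier_def
proof (intro conjI allI)
  have f: "integrable circle_measure f" using assms(1) by (simp add: vanishing_fourier_def)
  note [measurable] = borel_measurable_integrable[OF f] Linf_measurable[OF assms(2)]
  show "integrable circle_measure (\<lambda>z. \<phi> z * f z)" by (rule integrable_Linf_mult[OF f assms(2)])
  fix n
  have "fourier_coeff (\<lambda>z. \<phi> z * f z) n = fourier_coeff f (n - m)"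
    unfolding fourier_coeff_def
  proof (rule integral_cong_AE)
    show "AE z in circle_measure. \<phi> z * f z * z powi (- n) = f z * z powi (- (n - m))"
      using assms(3) AE_circle_measure_nonzero
      by eventually_elim (simp add: power_int_add[symmetric] mult_ac power_int_diff power_int_minus field_simps)
  qed simp_all
  then show "fourier_coeff (\<lambda>z. \<phi> z * f z) n = 0"
    using assms(1) by (simp add: vanishing_fourier_def)
qed

lemma bounded_linear_complex_real:
  assumes "bounded_linear (p :: complex \<Rightarrow> real)"
  obtains a where "\<And>z. complex_of_real (p z) = a * z + cnj a * cnj z"
proof
  fix z
  interpret bounded_linear p by (rule assms)
  have "z = Re z *\<^sub>R 1 + Im z *\<^sub>R \<i>" by (simp add: complex_eq_iff)
  then have "p z = Re z * p 1 + Im z * p \<i>"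
    by (metis add scaleR real_scaleR_def)
  then show "complex_of_real (p z) = Complex (p 1 / 2) (- p \<i> / 2) * z + cnj (Complex (p 1 / 2) (- p \<i> / 2)) * cnj z"
    by (simp add: complex_eq_iff field_simps)
qed

text \<open>
  Multiplication by \<open>z\<close> or by its inverse shifts the Fourier coefficients. On the circle the
  inverse is the complex conjugate, and so every polynomial in the real and the imaginary part
  preserves the vanishing of all coefficients.
\<close>

lemma vanishing_fourier_real_polynomial:
  assumes "real_polynomial_function p" "vanishing_fourier f"
  shows "vanishing_fourier (\<lambda>z. complex_of_real (p z) * f z)"
  using assms
proof (induction p arbitrary: f)
  case (linear p)
  then obtain a where a: "\<And>z. complex_of_real (p z) = a * z + cnj a * cnj z"
    using bounded_linear_complex_real by metis
  have "vanishing_fourier (\<lambda>z. z * f z)"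
    by (rule vanishing_fourier_powi[where m = 1]) (use linear Linf_ident in auto)
  moreover have "vanishing_fourier (\<lambda>z. cnj z * f z)"
    by (rule vanishing_fourier_powi[where m = "-1"])
      (use linear Linf_cnj[OF Linf_ident] AE_circle_measure_cnj_inverse in \<open>auto simp: power_int_minus\<close>)
  ultimately have "vanishing_fourier (\<lambda>z. a * (z * f z) + cnj a * (cnj z * f z))"
    by (intro vanishing_fourier_add vanishing_fourier_cmult)
  then show ?case by (simp add: a algebra_simps)
next
  case (const c)
  then show ?case by (rule vanishing_fourier_cmult)
next
  case (add p q)
  then have "vanishing_fourier (\<lambda>z. complex_of_real (p z) * f z + complex_of_real (q z) * f z)"
    by (intro vanishing_fourier_add) auto
  then show ?case by (simp add: algebra_simps)
next
  case (mult p q)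
  have "vanishing_fourier (\<lambda>z. complex_of_real (p z) * (complex_of_real (q z) * f z))"
    by (rule mult.IH(1), rule mult.IH(2), rule mult.prems)
  then show ?case by (simp add: mult.assoc)
qed

lemma vanishing_fourier_integral_continuous:
  fixes g :: "complex \<Rightarrow> real"
  assumes f: "vanishing_fourier f" and g: "continuous_on UNIV g" and bd: "\<And>z. \<bar>g z\<bar> \<le> B"
  shows "(LINT z|circle_measure. complex_of_real (g z) * f z) = 0"
proof -
  have fi: "integrable circle_measure f" using f by (simp add: vanishing_fourier_def)
  have gm [measurable]: "g \<in> borel_measurable borel"
    using g by (rule borel_measurable_continuous_onI)
  have gi: "integrable circle_measure (\<lambda>z. complex_of_real (g z) * f z)"
    by (rule integrable_Linf_mult[OF fi]) (rule LinfI[of _ B], use bd in auto)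
  define I where "I = (LINT z|circle_measure. norm (f z))"
  have I0: "0 \<le> I" unfolding I_def by simp
  have small: "norm (LINT z|circle_measure. complex_of_real (g z) * f z) \<le> e * I" if e: "e > 0" for e
  proof -
    obtain p where p: "real_polynomial_function p" "\<And>z. z \<in> sphere 0 1 \<Longrightarrow> \<bar>g z - p z\<bar> < e"
      using Stone_Weierstrass_real_polynomial_function[OF compact_sphere continuous_on_subset[OF g subset_UNIV] e]
      by blast
    have v: "vanishing_fourier (\<lambda>z. complex_of_real (p z) * f z)"
      by (rule vanishing_fourier_real_polynomial[OF p(1) f])
    have pi: "integrable circle_measure (\<lambda>z. complex_of_real (p z) * f z)"
      using v by (simp add: vanishing_fourier_def)
    have "fourier_coeff (\<lambda>z. complex_of_real (p z) * f z) 0 = 0"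
      using v by (simp add: vanishing_fourier_def)
    then have p0: "(LINT z|circle_measure. complex_of_real (p z) * f z) = 0"
      by (simp add: fourier_coeff_def)
    have "(LINT z|circle_measure. complex_of_real (g z) * f z)
        = (LINT z|circle_measure. complex_of_real (g z) * f z - complex_of_real (p z) * f z)"
      using gi pi p0 by simp
    also have "norm \<dots> \<le> (LINT z|circle_measure. norm (complex_of_real (g z) * f z - complex_of_real (p z) * f z))"
      by (rule integral_norm_bound)
    also have "\<dots> \<le> (LINT z|circle_measure. e * norm (f z))"
    proof (rule integral_mono_AE)
      show "AE z in circle_measure. norm (complex_of_real (g z) * f z - complex_of_real (p z) * f z) \<le> e * norm (f z)"
        using AE_circle_measure_norm
      proof eventually_elim
        case (elim z)
        then have "\<bar>g z - p z\<bar> \<le> e" using p(2)[of z] by simp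
        then show ?case
          by (simp flip: left_diff_distrib of_real_diff add: norm_mult mult_right_mono)
      qed
    qed (use gi pi fi in auto)
    also have "\<dots> = e * I" by (simp add: I_def)
    finally show ?thesis .
  qed
  have "norm (LINT z|circle_measure. complex_of_real (g z) * f z) \<le> 0"
  proof (rule field_le_epsilon)
    fix e :: real assume e: "e > 0"
    have "e / (I + 1) * I \<le> e" using e I0 by (simp add: field_simps)
    then show "norm (LINT z|circle_measure. complex_of_real (g z) * f z) \<le> 0 + e"
      using small[of "e / (I + 1)"] e I0 by simp
  qed
  then show ?thesis by simp
qed

text \<open>
  The integral against continuous functions vanishes by Weierstrass approximation, hence the
  integral over every closed set, since its indicator is a bounded pointwise limit of
  continuous functions. Closed sets generate the Borel sets.
\<close>

theorem vanishing_fourier_AE_zero: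
  assumes f: "vanishing_fourier f"
  shows "AE z in circle_measure. f z = 0"
proof (rule circle.density_zero)
  show fi: "integrable circle_measure f" using f by (simp add: vanishing_fourier_def)
  note [measurable] = borel_measurable_integrable[OF fi]
  have int0: "set_lebesgue_integral circle_measure UNIV f = 0"
    using vanishing_fourier_integral_continuous[OF f, of "\<lambda>z. 1" 1] by (simp add: set_lebesgue_integral_def)
  have closed: "set_lebesgue_integral circle_measure C f = 0" if C: "closed C" for C
  proof (cases "C = {}")
    case False
    define g where "g n z = max 0 (1 - real n * infdist z C)" for n :: nat and z
    have cg: "continuous_on UNIV (g n)" for n unfolding g_def by (intro continuous_intros)
    have gb: "\<bar>g n z\<bar> \<le> 1" for n z using infdist_nonneg[of z C] by (auto simp: g_def)
    have [measurable]: "g n \<in> borel_measurable borel" for n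
      using cg by (rule borel_measurable_continuous_onI)
    have [measurable]: "C \<in> sets borel" using C by simp
    have lim: "(\<lambda>n. g n z) \<longlonglongrightarrow> indicator C z" for z
    proof (cases "z \<in> C")
      case True
      then show ?thesis by (simp add: g_def)
    next
      case nz: False
      have pos: "infdist z C > 0" using infdist_pos_not_in_closed[OF C False nz] .
      then obtain N where N: "1 < real N * infdist z C" using ex_less_of_nat_mult by blast
      have "\<forall>\<^sub>F n in sequentially. g n z = 0"
        using eventually_ge_at_top[of N]
      proof eventually_elim
        case (elim n)
        have "real N * infdist z C \<le> real n * infdist z C" using elim pos by (intro mult_right_mono) auto
        then show ?case using N by (simp add: g_def)
      qed
      then show ?thesis using nz by (simp add: tendsto_eventually)
    qed
    have "(\<lambda>n. LINT z|circle_measure. complex_of_real (g n z) * f z)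
        \<longlonglongrightarrow> (LINT z|circle_measure. complex_of_real (indicator C z) * f z)"
    proof (rule integral_dominated_convergence)
      show "integrable circle_measure (\<lambda>z. norm (f z))" using fi by simp
      show "AE z in circle_measure. (\<lambda>n. complex_of_real (g n z) * f z) \<longlonglongrightarrow> complex_of_real (indicator C z) * f z"
        by (intro AE_I2 tendsto_intros lim)
      show "AE z in circle_measure. norm (complex_of_real (g n z) * f z) \<le> norm (f z)" for n
        using mult_right_mono[OF gb, of "norm (f _)"] by (intro AE_I2) (simp add: norm_mult)
    qed simp_all
    moreover have "(LINT z|circle_measure. complex_of_real (g n z) * f z) = 0" for n
      by (rule vanishing_fourier_integral_continuous[OF f cg gb])
    ultimately have "(LINT z|circle_measure. complex_of_real (indicator C z) * f z) = 0"
      by (simp add: LIMSEQ_const_iff)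
    then show ?thesis by (simp add: set_lebesgue_integral_def scaleR_conv_of_real)
  qed (simp add: set_lebesgue_integral_def)
  have int: "set_integrable circle_measure A f" if "A \<in> sets borel" for A
    using fi that by (simp add: set_integrable_def integrable_mult_indicator)
  fix A assume "A \<in> sets circle_measure"
  then have A: "A \<in> sigma_sets UNIV (Collect closed)"
    by (simp add: borel_eq_closed)
  have bs: "sigma_sets UNIV (Collect closed) = sets (borel :: complex measure)"
    by (simp add: borel_eq_closed)
  have st: "Int_stable (Collect closed :: complex set set)" by (auto simp: Int_stable_def)
  have sub: "(Collect closed :: complex set set) \<subseteq> Pow UNIV" by simp
  show "set_lebesgue_integral circle_measure A f = 0"
    using st sub A
  proof (induction rule: sigma_sets_induct_disjoint)
    case (basic C)
    then show ?case using closed by simp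
  next
    case empty
    show ?case by (simp add: set_lebesgue_integral_def)
  next
    case (compl B)
    then have B: "B \<in> sets borel" by (simp add: bs)
    have "set_lebesgue_integral circle_measure ((UNIV - B) \<union> B) f
        = set_lebesgue_integral circle_measure (UNIV - B) f + set_lebesgue_integral circle_measure B f"
      by (rule set_integral_Un) (use B int in auto)
    then show ?case using int0 compl.IH by (simp add: Un_commute)
  next
    case (union B)
    then have B: "B i \<in> sets borel" for i by (auto simp: bs)
    have "set_lebesgue_integral circle_measure (\<Union>i. B i) f = (\<Sum>i. set_lebesgue_integral circle_measure (B i) f)"
    proof (rule lebesgue_integral_countable_add)
      show "set_integrable circle_measure (\<Union>i. B i) f" using B by (intro int) blast
    qed (use B union(1) in \<open>auto simp: disjoint_family_on_def\<close>)
    then show ?case using union.IH by simp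
  qed
qed

section \<open>Monomials and the Hardy space\<close>

lemma integral_circle_measure:
  assumes "f \<in> borel_measurable borel"
  shows "(LINT z|circle_measure. f z) = (1 / (2 * pi)) *\<^sub>R (LINT t:{-pi..pi}|lborel. (f (cis t) :: complex))"
proof -
  note [measurable] = assms
  have u: "uniform_measure lborel {-pi..pi} = density lborel (\<lambda>t. ennreal (indicator {-pi..pi} t / (2 * pi)))"
    unfolding uniform_measure_def
  proof (rule density_cong)
    show "AE t in lborel. indicator {-pi..pi} t / emeasure lborel {-pi..pi} = ennreal (indicator {-pi..pi} t / (2 * pi))"
      by (intro AE_I2) (simp add: indicator_def divide_ennreal flip: ennreal_1)
  qed simp_all
  have "(LINT z|circle_measure. f z) = (LINT t|uniform_measure lborel {-pi..pi}. f (cis t))"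
    unfolding circle_measure_def by (rule integral_distr) simp_all
  also have "\<dots> = (LINT t|lborel. (indicator {-pi..pi} t / (2 * pi)) *\<^sub>R f (cis t))"
    unfolding u by (rule integral_density) simp_all
  also have "\<dots> = (LINT t|lborel. (1 / (2 * pi)) *\<^sub>R (indicator {-pi..pi} t *\<^sub>R f (cis t)))"
    by (intro Bochner_Integration.integral_cong) auto
  also have "\<dots> = (1 / (2 * pi)) *\<^sub>R (LINT t:{-pi..pi}|lborel. f (cis t))"
    unfolding set_lebesgue_integral_def by (rule integral_scaleR_right)
  finally show ?thesis .
qed

lemma integral_powi_circle_measure:
  assumes "n \<noteq> 0"
  shows "(LINT z|circle_measure. z powi n) = 0"
proof -
  define F where "F t = cis (of_int n * t) / (\<i> * of_int n)" for t :: real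
  have F: "(F has_vector_derivative cis (of_int n * t)) (at t within S)" for t S
  proof -
    have "((\<lambda>z. exp (\<i> * of_int n * z) / (\<i> * of_int n)) has_field_derivative exp (\<i> * of_int n * of_real t))
        (at (of_real t))"
      using assms by (auto intro!: derivative_eq_intros)
    from has_vector_derivative_real_field[OF this] show ?thesis
      by (simp add: F_def[abs_def] cis_conv_exp mult.assoc)
  qed
  have "(LINT t:{-pi..pi}|lborel. cis (of_int n * t)) = F pi - F (-pi)"
    unfolding set_lebesgue_integral_def
    by (rule integral_FTC_Icc) (auto intro!: continuous_intros F)
  also have "\<dots> = 0"
  proof -
    have "sin (of_int n * pi) = 0" using sin_npi_int[of n] by (simp add: mult.commute)
    then have "cis (of_int n * pi) = cis (of_int n * - pi)" by (simp add: complex_eq_iff)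
    then show ?thesis by (simp add: F_def)
  qed
  finally have 0: "(LINT t:{-pi..pi}|lborel. cis (of_int n * t)) = 0" .
  have "(LINT z|circle_measure. z powi n) = (1 / (2 * pi)) *\<^sub>R (LINT t:{-pi..pi}|lborel. cis t powi n)"
    by (rule integral_circle_measure) simp
  then show ?thesis by (simp add: 0 cis_power_int)
qed

definition monomial :: "int \<Rightarrow> L2" where
  "monomial n = abs_L2 (\<lambda>z. z powi n)"

lemma square_integrable_powi: "square_integrable (\<lambda>z. z powi n)"
  by (rule square_integrable_Linf[OF Linf_powi])

lemma AE_circle_measure_cnj_powi: "AE z in circle_measure. cnj (z powi n) = z powi (- n)"
  using AE_circle_measure_cnj_inverse
  by eventually_elim (simp add: power_int_minus power_int_inverse)

lemma monomial_0: "monomial 0 = abs_L2 (\<lambda>z. 1)"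
  by (simp add: monomial_def)

lemma abs_L2_cnj: "abs_L2 cnj = monomial (-1)"
  unfolding monomial_def
proof (rule abs_L2_cong)
  show "square_integrable cnj" by (rule square_integrable_Linf[OF Linf_cnj[OF Linf_ident]])
  show "AE z in circle_measure. cnj z = z powi (-1)"
    using AE_circle_measure_cnj_inverse by eventually_elim (simp add: power_int_minus)
qed (rule square_integrable_powi)

lemma fourier_coeff_eq_cinner:
  assumes "square_integrable f"
  shows "fourier_coeff f n = cinner (abs_L2 f) (monomial n)"
proof -
  note [measurable] = square_integrable_measurable[OF assms]
  have "fourier_coeff f n = (LINT z|circle_measure. f z * cnj (z powi n))"
    unfolding fourier_coeff_def
  proof (rule integral_cong_AE)
    show "AE z in circle_measure. f z * z powi (- n) = f z * cnj (z powi n)"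
      using AE_circle_measure_cnj_powi[of n] by eventually_elim simp
  qed simp_all
  then show ?thesis by (simp add: monomial_def cinner_abs_L2 assms square_integrable_powi)
qed

lemma fourier_coeff_rep_L2: "fourier_coeff (rep_L2 f) n = cinner f (monomial n)"
  using fourier_coeff_eq_cinner[OF square_integrable_rep[of f]] by simp

theorem L2_eq_zero_if_orthogonal_monomials:
  assumes "\<And>n. cinner f (monomial n) = 0"
  shows "f = 0"
proof -
  have "integrable circle_measure (rep_L2 f)"
    using integrable_mult_cnj[OF square_integrable_rep[of f] square_integrable_powi[of 0]] by simp
  then have "vanishing_fourier (rep_L2 f)"
    using assms by (simp add: vanishing_fourier_def fourier_coeff_rep_L2)
  then have "AE z in circle_measure. rep_L2 f z = 0" by (rule vanishing_fourier_AE_zero)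
  then have "abs_L2 (rep_L2 f) = abs_L2 (\<lambda>z. 0)"
    by (intro abs_L2_cong square_integrable_rep square_integrable_zero)
  then show ?thesis by (simp add: zero_L2.abs_eq)
qed

lemma mult_ident_monomial: "mult_op (\<lambda>z. z) (monomial n) = monomial (n + 1)"
proof -
  have "mult_op (\<lambda>z. z) (monomial n) = abs_L2 (\<lambda>z. z * z powi n)"
    by (simp add: monomial_def mult_op_abs_L2 Linf_ident square_integrable_powi)
  also have "\<dots> = monomial (n + 1)"
    unfolding monomial_def
    using AE_circle_measure_nonzero
    by (intro abs_L2_cong square_integrable_mult_Linf[OF Linf_ident] square_integrable_powi)
      (auto elim!: eventually_mono simp: power_int_add)
  finally show ?thesis .
qed

lemma mult_cnj_mult_ident [simp]:
  "mult_op cnj (mult_op (\<lambda>z. z) h) = h" "mult_op (\<lambda>z. z) (mult_op cnj h) = h"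
  using mult_op_cnj_cancel[OF Linf_ident AE_circle_measure_norm, of h] by simp_all

lemma mult_cnj_monomial: "mult_op cnj (monomial n) = monomial (n - 1)"
  using mult_ident_monomial[of "n - 1"] mult_cnj_mult_ident(1)[of "monomial (n - 1)"] by simp

lemma cinner_mult_ident: "cinner (mult_op (\<lambda>z. z) f) g = cinner f (mult_op cnj g)"
  using cinner_mult_op[OF Linf_ident] by simp

lemma cinner_mult_cnj: "cinner (mult_op cnj f) g = cinner f (mult_op (\<lambda>z. z) g)"
  using cinner_mult_op[OF Linf_cnj[OF Linf_ident]] by simp

lemma cinner_monomial: "cinner (monomial m) (monomial n) = (if m = n then 1 else 0)"
proof -
  have "cinner (monomial m) (monomial n) = (LINT z|circle_measure. z powi m * cnj (z powi n))"
    by (simp add: monomial_def cinner_abs_L2 square_integrable_powi)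
  also have "\<dots> = (LINT z|circle_measure. z powi (m - n))"
  proof (rule integral_cong_AE)
    show "AE z in circle_measure. z powi m * cnj (z powi n) = z powi (m - n)"
      using AE_circle_measure_cnj_powi[of n] AE_circle_measure_nonzero
      by eventually_elim (simp add: power_int_diff power_int_minus divide_inverse)
  qed simp_all
  also have "\<dots> = (if m = n then 1 else 0)"
    using integral_powi_circle_measure[of "m - n"]
    by (simp add: measure_def emeasure_circle_measure_UNIV)
  finally show ?thesis .
qed

lemma H2_iff: "f \<in> H2 \<longleftrightarrow> (\<forall>n<0. cinner f (monomial n) = 0)"
  by (simp add: H2_def fourier_coeff_rep_L2)

lemma closed_csubspace_orthogonal: "closed_csubspace {f. \<forall>g\<in>G. cinner f g = 0}"
  unfolding closed_csubspace_def
proof (intro conjI)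
  show "closed {f. \<forall>g\<in>G. cinner f g = 0}"
    unfolding closed_sequential_limits
  proof safe
    fix x l g assume "\<forall>n. x n \<in> {f. \<forall>g\<in>G. cinner f g = 0}" "x \<longlonglongrightarrow> l" "g \<in> G"
    then have "(\<lambda>n. cinner (x n) g) \<longlonglongrightarrow> cinner l g" "\<And>n. cinner (x n) g = 0"
      using tendsto_cinner[of x l] by blast+
    then show "cinner l g = 0" by (simp add: LIMSEQ_const_iff)
  qed
qed (auto simp: cinner_add_left cinner_scaleC_left)

lemma closed_csubspace_H2: "closed_csubspace H2"
proof -
  have "H2 = {f. \<forall>g\<in>monomial ` {..<0}. cinner f g = 0}" by (auto simp: H2_iff)
  then show ?thesis by (rule ssubst) (rule closed_csubspace_orthogonal)
qed

lemmas H2_scaleC = closed_csubspaceD(3)[OF closed_csubspace_H2]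
  and H2_diff = closed_csubspaceD(4)[OF closed_csubspace_H2]

lemma monomial_in_H2: "n \<ge> 0 \<Longrightarrow> monomial n \<in> H2"
  by (simp add: H2_iff cinner_monomial)

lemma proj_P_in_H2: "proj_P f \<in> H2"
  unfolding proj_P_def by (rule orthogonal_proj(1)[OF closed_csubspace_H2])

lemma proj_Q_orthogonal: "h \<in> H2 \<Longrightarrow> cinner (proj_Q f) h = 0"
  unfolding proj_Q_def proj_P_def by (rule orthogonal_proj(2)[OF closed_csubspace_H2])

text \<open>
  The projection onto \<open>H2\<close> of such an \<open>f\<close> has no nonzero Fourier coefficient at all.
\<close>

lemma orthogonal_H2I:
  assumes "\<And>n. n \<ge> 0 \<Longrightarrow> cinner f (monomial n) = 0" "h \<in> H2"
  shows "cinner f h = 0"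
proof -
  have "cinner (proj_P f) (monomial n) = 0" for n
  proof (cases "n < 0")
    case True
    then show ?thesis using proj_P_in_H2 by (simp add: H2_iff)
  next
    case False
    then show ?thesis
      using proj_Q_orthogonal[OF monomial_in_H2, of n f] assms(1)[of n] by (simp add: proj_Q_def cinner_diff_left)
  qed
  then have "proj_P f = 0" by (rule L2_eq_zero_if_orthogonal_monomials)
  then show ?thesis using proj_Q_orthogonal[OF assms(2), of f] by (simp add: proj_Q_def)
qed

lemma mult_ident_H2:
  assumes "h \<in> H2"
  shows "mult_op (\<lambda>z. z) h \<in> H2"
  using assms by (simp add: H2_iff cinner_mult_ident mult_cnj_monomial)

text \<open>Only the constant term of \<open>h\<close> can keep \<open>h / z\<close> out of \<open>H2\<close>.\<close>

lemma backward_shift_H2: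
  assumes "h \<in> H2"
  shows "mult_op cnj (h - scaleC (cinner h (monomial 0)) (monomial 0)) \<in> H2"
  unfolding H2_iff
proof (intro allI impI)
  fix n :: int assume "n < 0"
  then show "cinner (mult_op cnj (h - scaleC (cinner h (monomial 0)) (monomial 0))) (monomial n) = 0"
    using assms by (cases "n = -1")
      (auto simp: H2_iff cinner_mult_cnj mult_ident_monomial cinner_diff_left cinner_scaleC_left cinner_monomial)
qed

section \<open>Inner functions, model spaces and their complements\<close>

text \<open>
  Outside the disk \<open>F\<close> is arbitrary and need not be measurable. The indicator of the circle
  removes these values without changing an integral over the circle.
\<close>

lemma borel_measurable_dilation:
  assumes F: "F holomorphic_on ball 0 1" and r: "0 \<le> r" "r < 1"
  shows "(\<lambda>z. indicator (sphere 0 1) z *\<^sub>R F (complex_of_real r * z) * z powi m)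
    \<in> borel_measurable circle_measure"
proof -
  have "(\<lambda>z. indicator (sphere 0 1) z *\<^sub>R F (complex_of_real r * z)) \<in> borel_measurable borel"
  proof (rule borel_measurable_continuous_on_indicator)
    show "continuous_on (sphere 0 1) (\<lambda>z. F (complex_of_real r * z))"
      by (rule continuous_on_compose2[OF holomorphic_on_imp_continuous_on[OF F]])
        (use r in \<open>auto intro!: continuous_intros simp: norm_mult\<close>)
  qed simp
  from borel_measurable_times[OF this powi_measurable] show ?thesis
    by (simp only: measurable_cong_sets[OF sets_circle_measure refl])
qed

text \<open>
  On the circle of radius \<open>r < 1\<close> the Taylor series of \<open>F\<close> converges absolutely and may be
  integrated term by term; each term is a multiple of a positive power of \<open>z\<close>.
\<close>

lemma integral_dilation_eq_zero:
  assumes F: "F holomorphic_on ball 0 1" and r: "0 \<le> r" "r < 1" and m: "m > 0"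
  shows "(LINT z|circle_measure. indicator (sphere 0 1) z *\<^sub>R F (complex_of_real r * z) * z powi m) = 0"
proof -
  define a where "a n = (deriv ^^ n) F 0 / fact n" for n
  have ps: "(\<lambda>n. a n * w ^ n) sums F w" if "norm w < 1" for w
    using holomorphic_power_series[OF F, of w] that by (simp add: a_def)
  define f where "f n z = a n * (complex_of_real r * z) ^ n * z powi m" for n and z
  have [measurable]: "f n \<in> borel_measurable borel" for n
    unfolding f_def by simp
  have "summable (\<lambda>n. a n * complex_of_real ((1 + r) / 2) ^ n)"
    by (rule sums_summable[OF ps]) (use r in \<open>simp del: of_real_add of_real_divide\<close>)
  then have "summable (\<lambda>n. norm (a n * complex_of_real r ^ n))"
    by (rule powser_insidea) (use r in \<open>simp del: of_real_add of_real_divide\<close>)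
  then have sm: "summable (\<lambda>n. norm (a n) * r ^ n)"
    using r by (simp add: norm_mult norm_power)
  have fn: "norm (f n z) = norm (a n) * r ^ n" if "norm z = 1" for n z
    using that r by (simp add: f_def norm_mult norm_power norm_power_int)
  have AEfn: "AE z in circle_measure. norm (f n z) = norm (a n) * r ^ n" for n
    using AE_circle_measure_norm by eventually_elim (rule fn)
  have fi: "integrable circle_measure (f n)" for n
    by (rule circle.integrable_const_bound[of _ "norm (a n) * r ^ n"]) (use AEfn[of n] in auto)
  have "(LINT z|circle_measure. indicator (sphere 0 1) z *\<^sub>R F (complex_of_real r * z) * z powi m)
      = (LINT z|circle_measure. (\<Sum>n. f n z))"
  proof (rule integral_cong_AE)
    show "(\<lambda>z. indicator (sphere 0 1) z *\<^sub>R F (complex_of_real r * z) * z powi m) \<in> borel_measurable circle_measure"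
      by (rule borel_measurable_dilation[OF F r])
    show "AE z in circle_measure. indicator (sphere 0 1) z *\<^sub>R F (complex_of_real r * z) * z powi m = (\<Sum>n. f n z)"
      using AE_circle_measure_norm
    proof eventually_elim
      case (elim z)
      then have "(\<lambda>n. f n z) sums (F (complex_of_real r * z) * z powi m)"
        unfolding f_def using r by (intro sums_mult2 ps) (simp add: norm_mult)
      then show ?case using elim by (simp add: sums_iff)
    qed
  qed simp
  also have "\<dots> = (\<Sum>n. LINT z|circle_measure. f n z)"
  proof (rule integral_suminf)
    have "AE z in circle_measure. \<forall>n. norm (f n z) = norm (a n) * r ^ n"
      using AEfn by (simp add: AE_all_countable)
    then show "AE z in circle_measure. summable (\<lambda>n. norm (f n z))"
      by eventually_elim (simp add: sm)
    have "(LINT z|circle_measure. norm (f n z)) = (LINT z|circle_measure. norm (a n) * r ^ n)" for n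
      by (rule integral_cong_AE) (use AEfn in auto)
    then show "summable (\<lambda>n. LINT z|circle_measure. norm (f n z))"
      using sm by (simp add: measure_def emeasure_circle_measure_UNIV)
  qed (rule fi)
  also have "\<dots> = 0"
  proof -
    have "(LINT z|circle_measure. f n z) = 0" for n
    proof -
      have "(LINT z|circle_measure. f n z) = (LINT z|circle_measure. (a n * complex_of_real r ^ n) * z powi (int n + m))"
      proof (rule integral_cong_AE)
        show "AE z in circle_measure. f n z = (a n * complex_of_real r ^ n) * z powi (int n + m)"
          using AE_circle_measure_nonzero
          by eventually_elim (simp add: f_def power_int_add power_mult_distrib)
      qed simp_all
      then show ?thesis using integral_powi_circle_measure[of "int n + m"] m by simp
    qed
    then show ?thesis by simp
  qed
  finally show ?thesis .
qed

lemma inner_fun_Linf: "inner_fun \<theta> \<Longrightarrow> \<theta> \<in> Linf"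
  by (rule LinfI[of _ 1]) (auto simp: inner_fun_def elim: eventually_mono)

text \<open>
  The dilations \<open>z \<mapsto> F (r z)\<close> of the bounded holomorphic extension have no negative Fourier
  coefficients, and they converge boundedly to \<open>\<theta>\<close> as \<open>r \<rightarrow> 1\<close>.
\<close>

theorem inner_fun_in_H2:
  assumes "inner_fun \<theta>"
  shows "abs_L2 \<theta> \<in> H2"
proof -
  have [measurable]: "\<theta> \<in> borel_measurable circle_measure" using assms by (simp add: inner_fun_def)
  obtain F where F: "F holomorphic_on ball 0 1" "bounded (F ` ball 0 1)"
      "AE z in circle_measure. ((\<lambda>r. F (complex_of_real r * z)) \<longlongrightarrow> \<theta> z) (at_left 1)"
    using assms by (auto simp: inner_fun_def)
  obtain B where B: "\<And>w. norm w < 1 \<Longrightarrow> norm (F w) \<le> B"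
    using F(2) unfolding bounded_iff by (metis imageI mem_ball_0)
  define r where "r j = 1 - 1 / real (Suc j)" for j :: nat
  have r: "0 \<le> r j" "r j < 1" for j by (auto simp: r_def)
  have "r \<longlonglongrightarrow> 1 - 0"
    unfolding r_def by (intro tendsto_diff tendsto_const LIMSEQ_Suc lim_1_over_n)
  then have rlim: "filterlim r (at_left 1) sequentially"
    using r(2) by (simp add: filterlim_at eventually_True less_imp_neq)
  show ?thesis
    unfolding H2_iff
  proof (intro allI impI)
    fix n :: int assume n: "n < 0"
    define h where "h j z = indicator (sphere 0 1) z *\<^sub>R F (complex_of_real (r j) * z) * z powi (- n)" for j z
    have "(\<lambda>j. LINT z|circle_measure. h j z) \<longlonglongrightarrow> (LINT z|circle_measure. \<theta> z * z powi (- n))"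
    proof (rule integral_dominated_convergence)
      show "integrable circle_measure (\<lambda>z. B)" by simp
      show "AE z in circle_measure. (\<lambda>j. h j z) \<longlonglongrightarrow> \<theta> z * z powi (- n)"
        using F(3) AE_circle_measure_norm
      proof eventually_elim
        case (elim z)
        have "(\<lambda>j. F (complex_of_real (r j) * z)) \<longlonglongrightarrow> \<theta> z"
          by (rule filterlim_compose[OF elim(1) rlim])
        then show ?case unfolding h_def using elim(2) by (intro tendsto_intros) simp
      qed
      show "AE z in circle_measure. norm (h j z) \<le> B" for j
        using AE_circle_measure_norm
      proof eventually_elim
        case (elim z)
        then show ?case
          using B[of "complex_of_real (r j) * z"] r[of j] by (simp add: h_def norm_mult norm_power_int)
      qed
      show "h j \<in> borel_measurable circle_measure" for j
        unfolding h_def by (rule borel_measurable_dilation[OF F(1) r])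
    qed simp
    moreover have "(LINT z|circle_measure. h j z) = 0" for j
      unfolding h_def by (rule integral_dilation_eq_zero[OF F(1) r]) (use n in simp)
    ultimately have "fourier_coeff \<theta> n = 0"
      by (simp add: fourier_coeff_def LIMSEQ_const_iff)
    then show "cinner (abs_L2 \<theta>) (monomial n) = 0"
      using fourier_coeff_eq_cinner[OF square_integrable_Linf[OF inner_fun_Linf[OF assms]]] by simp
  qed
qed

locale inner_function =
  fixes \<theta> :: "complex \<Rightarrow> complex"
  assumes inner: "inner_fun \<theta>"
begin

abbreviation M where "M \<equiv> mult_op \<theta>"
abbreviation S where "S \<equiv> mult_op (\<lambda>z. z)"
abbreviation T where "T \<equiv> mult_op cnj"
abbreviation Q where "Q \<equiv> proj_Q\<theta> \<theta>"
abbreviation \<theta>0 where "\<theta>0 \<equiv> fourier_coeff \<theta> 0"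

lemma Linf: "\<theta> \<in> Linf" "(\<lambda>z. cnj (\<theta> z)) \<in> Linf" "(\<lambda>z. z) \<in> Linf" "cnj \<in> Linf"
  using inner_fun_Linf[OF inner] by (simp_all add: Linf_cnj[of "\<lambda>z. z", simplified] Linf_cnj Linf_ident)

lemma norm_theta: "AE z in circle_measure. norm (\<theta> z) = 1"
  using inner by (simp add: inner_fun_def)

lemma cinner_M_M: "cinner (M f) (M g) = cinner f g"
  by (simp add: cinner_mult_op[OF Linf(1)] mult_op_cnj_cancel[OF Linf(1) norm_theta])

lemma M_S: "M (S f) = S (M f)" and M_T: "M (T f) = T (M f)"
  by (simp_all add: mult_op_commute Linf)

lemma M_monomial_0: "M (monomial 0) = abs_L2 \<theta>"
  by (simp add: monomial_0 mult_op_abs_L2 Linf square_integrable_Linf Linf_const)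

lemma theta0_eq: "\<theta>0 = cinner (abs_L2 \<theta>) (monomial 0)"
  by (rule fourier_coeff_eq_cinner[OF square_integrable_Linf[OF Linf(1)]])

lemma M_monomial_H2: "M (monomial (int n)) \<in> H2"
proof (induction n)
  case 0
  then show ?case by (simp add: M_monomial_0 inner_fun_in_H2[OF inner])
next
  case (Suc n)
  have "M (monomial (int (Suc n))) = S (M (monomial (int n)))"
    by (simp add: M_S[symmetric] mult_ident_monomial add.commute)
  then show ?case using mult_ident_H2[OF Suc] by simp
qed

text \<open>
  Instead of expanding \<open>h\<close> into a series, the factor \<open>\<theta>\<close> is moved to the other side of the inner
  product. It remains to see that the conjugate of \<open>\<theta>\<close> times a negative power of \<open>z\<close> is
  orthogonal to \<open>H2\<close>, and this can be tested on nonnegative powers.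
\<close>

lemma M_H2:
  assumes "h \<in> H2"
  shows "M h \<in> H2"
  unfolding H2_iff
proof (intro allI impI)
  fix n :: int assume n: "n < 0"
  have "cinner (mult_op (\<lambda>z. cnj (\<theta> z)) (monomial n)) h = 0"
  proof (rule orthogonal_H2I[OF _ assms])
    fix k :: int assume "k \<ge> 0"
    then have "M (monomial k) \<in> H2" using M_monomial_H2[of "nat k"] by simp
    then have "cinner (M (monomial k)) (monomial n) = 0" using n by (simp add: H2_iff)
    then show "cinner (mult_op (\<lambda>z. cnj (\<theta> z)) (monomial n)) (monomial k) = 0"
      by (simp add: cinner_mult_op[OF Linf(2)] cinner_eq_zero_commute[of "monomial n"])
  qed
  then show "cinner (M h) (monomial n) = 0"
    by (simp add: cinner_mult_op[OF Linf(1)] cinner_eq_zero_commute[of h])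
qed

lemma K_space_iff: "f \<in> K_space \<theta> \<longleftrightarrow> f \<in> H2 \<and> (\<forall>g\<in>H2. cinner f (M g) = 0)"
  by (auto simp: K_space_def ominus_def)

lemma K_perp_iff: "f \<in> K_perp \<theta> \<longleftrightarrow> (\<forall>k\<in>K_space \<theta>. cinner f k = 0)"
  by (auto simp: K_perp_def ominus_def)

lemma K_perp_orthogonal: "f \<in> K_perp \<theta> \<Longrightarrow> k \<in> K_space \<theta> \<Longrightarrow> cinner f k = 0"
  by (simp add: K_perp_iff)

lemma closed_csubspace_K_space: "closed_csubspace (K_space \<theta>)"
proof -
  have "K_space \<theta> = {f. \<forall>g\<in>monomial ` {..<0} \<union> M ` H2. cinner f g = 0}"
    by (auto simp: K_space_iff H2_iff)
  then show ?thesis by (simp only: closed_csubspace_orthogonal)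
qed

lemma closed_csubspace_K_perp: "closed_csubspace (K_perp \<theta>)"
proof -
  have "K_perp \<theta> = {f. \<forall>g\<in>K_space \<theta>. cinner f g = 0}" by (auto simp: K_perp_iff)
  then show ?thesis by (simp only: closed_csubspace_orthogonal)
qed

lemmas K_space = closed_csubspaceD[OF closed_csubspace_K_space]
  and K_perp = closed_csubspaceD[OF closed_csubspace_K_perp]

lemma M_in_K_perp: "h \<in> H2 \<Longrightarrow> M h \<in> K_perp \<theta>"
  by (simp add: K_perp_iff K_space_iff cinner_eq_zero_commute[of "M h"])

lemma theta_in_K_perp: "abs_L2 \<theta> \<in> K_perp \<theta>"
  using M_in_K_perp[OF monomial_in_H2[of 0]] by (simp add: M_monomial_0)

lemma K_perp_if_orthogonal_H2: "(\<And>h. h \<in> H2 \<Longrightarrow> cinner f h = 0) \<Longrightarrow> f \<in> K_perp \<theta>"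
  by (simp add: K_perp_iff K_space_iff)

lemma monomial_in_K_perp: "n < 0 \<Longrightarrow> monomial n \<in> K_perp \<theta>"
  by (rule K_perp_if_orthogonal_H2) (simp add: H2_iff cinner_eq_zero_commute[of "monomial n"])

lemma Q_in_K_perp: "Q f \<in> K_perp \<theta>"
  unfolding proj_Q\<theta>_def
  by (intro K_perp(2) K_perp_if_orthogonal_H2 M_in_K_perp proj_P_in_H2 proj_Q_orthogonal)

text \<open>
  Together with the previous lemma this identifies \<open>Q\<close> as the orthogonal projection onto the
  complement; from here on only this property is used.
\<close>

lemma diff_Q_in_K_space: "f - Q f \<in> K_space \<theta>"
proof -
  let ?g = "mult_op (\<lambda>z. cnj (\<theta> z)) f"
  have eq: "f - Q f = proj_P f - M (proj_P ?g)" by (simp add: proj_Q\<theta>_def proj_Q_def)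
  have "cinner (f - Q f) (M h) = 0" if h: "h \<in> H2" for h
  proof -
    have "cinner (f - Q f) (M h) = cinner (f - M (proj_P ?g)) (M h) - cinner (proj_Q f) (M h)"
      by (simp add: eq proj_Q_def cinner_diff_left)
    also have "f - M (proj_P ?g) = M (proj_Q ?g)"
      by (simp add: proj_Q_def mult_op_diff[OF Linf(1)] mult_op_cnj_cancel[OF Linf(1) norm_theta])
    finally show ?thesis
      by (simp add: cinner_M_M proj_Q_orthogonal h M_H2)
  qed
  moreover have "f - Q f \<in> H2"
    unfolding eq by (intro H2_diff M_H2 proj_P_in_H2)
  ultimately show ?thesis by (simp add: K_space_iff)
qed

lemma Q_eqI:
  assumes "g \<in> K_perp \<theta>" "f - g \<in> K_space \<theta>"
  shows "Q f = g"
proof -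
  have "Q f - g \<in> K_perp \<theta>" by (intro K_perp(4) Q_in_K_perp assms)
  moreover have "(f - g) - (f - Q f) \<in> K_space \<theta>" by (intro K_space(4) diff_Q_in_K_space assms)
  ultimately have "cinner (Q f - g) (Q f - g) = 0"
    using K_perp_orthogonal by simp
  then show ?thesis by simp
qed

lemma Q_K_perp: "f \<in> K_perp \<theta> \<Longrightarrow> Q f = f"
  by (rule Q_eqI) (use K_space(1) in auto)

lemma Q_add: "Q (f + g) = Q f + Q g"
proof (rule Q_eqI)
  have "(f - Q f) + (g - Q g) \<in> K_space \<theta>" by (intro K_space(2) diff_Q_in_K_space)
  then show "f + g - (Q f + Q g) \<in> K_space \<theta>" by (simp add: algebra_simps)
qed (intro K_perp(2) Q_in_K_perp)

lemma Q_diff: "Q (f - g) = Q f - Q g"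
  using Q_add[of "f - g" g] by simp

lemma Q_scaleC: "Q (scaleC c f) = scaleC c (Q f)"
proof (rule Q_eqI)
  have "scaleC c (f - Q f) \<in> K_space \<theta>" by (intro K_space(3) diff_Q_in_K_space)
  then show "scaleC c f - scaleC c (Q f) \<in> K_space \<theta>" by (simp add: scaleC_diff_right)
qed (intro K_perp(3) Q_in_K_perp)

lemma cinner_Q_left: "g \<in> K_perp \<theta> \<Longrightarrow> cinner (Q f) g = cinner f g"
  using K_perp_orthogonal[OF _ diff_Q_in_K_space[of f], of g]
  by (simp add: cinner_eq_zero_commute[of g] cinner_diff_left)

lemma cinner_Q_right: "g \<in> K_perp \<theta> \<Longrightarrow> cinner g (Q f) = cinner g f"
  using cinner_Q_left[of g f] cinner_commute[of g f] cinner_commute[of g "Q f"] by simp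

lemma norm_Q_le: "norm (Q f) \<le> norm f"
proof -
  have "(norm (Q f))\<^sup>2 = inner f (Q f)"
    using cinner_Q_left[OF Q_in_K_perp, of f f] by (simp add: power2_norm_eq_inner inner_eq_Re_cinner)
  also have "\<dots> \<le> norm f * norm (Q f)" by (rule norm_cauchy_schwarz)
  finally show ?thesis by (cases "norm (Q f) = 0") (auto simp: power2_eq_square)
qed

text \<open>
  Orthogonality to the negative powers puts \<open>g\<close> into \<open>H2\<close>, and orthogonality to all \<open>\<theta> z\<^sup>n\<close> then
  into the model space, to which it is also orthogonal. Hence these functions span a dense
  subspace of the complement.
\<close>

lemma K_perp_eq_zero:
  assumes g: "g \<in> K_perp \<theta>"
    and neg: "\<And>n. n < 0 \<Longrightarrow> cinner g (monomial n) = 0"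
    and pos: "\<And>n. n \<ge> 0 \<Longrightarrow> cinner g (M (monomial n)) = 0"
  shows "g = 0"
proof -
  have "cinner g (M h) = 0" if "h \<in> H2" for h
  proof -
    have "cinner (mult_op (\<lambda>z. cnj (\<theta> z)) g) h = 0"
      using that by (rule orthogonal_H2I[rotated]) (use pos in \<open>simp add: cinner_mult_op[OF Linf(2)]\<close>)
    then show ?thesis by (simp add: cinner_mult_op[OF Linf(2)])
  qed
  then have "g \<in> K_space \<theta>" using neg by (simp add: K_space_iff H2_iff)
  then have "cinner g g = 0" by (rule K_perp_orthogonal[OF g])
  then show ?thesis by simp
qed

section \<open>The compressed shift\<close>

text \<open>
  The vector \<open>k0\<close> is the function \<open>(\<theta> - \<theta>0) / z\<close>, the projection of \<open>\<theta> / z\<close> onto the model space.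
  Multiplication by \<open>z\<close> leads out of the model space only in the direction of \<open>\<theta>\<close>, and division by
  \<open>z\<close> leads out of the complement only in the direction of \<open>k0\<close>. This is why the commutator of a
  Hankel operator with the shift has rank at most two.
\<close>

definition k0 :: L2 where
  "k0 = T (abs_L2 \<theta> - scaleC \<theta>0 (monomial 0))"

lemma k0_in_K_space: "k0 \<in> K_space \<theta>"
  unfolding K_space_iff
proof (intro conjI ballI)
  show "k0 \<in> H2"
    using backward_shift_H2[OF inner_fun_in_H2[OF inner]] by (simp add: k0_def theta0_eq)
  fix g assume g: "g \<in> H2"
  have z: "cinner (monomial 0) (S h) = 0" if "h \<in> H2" for h
    using that by (simp add: cinner_eq_zero_commute[of "monomial 0"] cinner_mult_ident mult_cnj_monomial H2_iff)
  have "cinner k0 (M g) = cinner (M (monomial 0)) (M (S g)) - \<theta>0 * cinner (monomial 0) (S (M g))"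
    by (simp add: k0_def cinner_mult_cnj cinner_diff_left cinner_scaleC_left M_S M_monomial_0)
  then show "cinner k0 (M g) = 0" by (simp add: cinner_M_M z g M_H2)
qed

lemma T_theta: "T (abs_L2 \<theta>) = k0 + scaleC \<theta>0 (monomial (-1))"
  by (simp add: k0_def mult_op_diff Linf mult_op_scaleC mult_cnj_monomial)

lemma S_K_space:
  assumes k: "k \<in> K_space \<theta>"
  shows "S k - scaleC (cinner k k0) (abs_L2 \<theta>) \<in> K_space \<theta>"
  unfolding K_space_iff
proof (intro conjI ballI)
  have kH: "k \<in> H2" and kM: "\<And>g. g \<in> H2 \<Longrightarrow> cinner k (M g) = 0"
    using k by (auto simp: K_space_iff)
  show "S k - scaleC (cinner k k0) (abs_L2 \<theta>) \<in> H2"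
    by (intro H2_diff H2_scaleC mult_ident_H2 inner_fun_in_H2 inner kH)
  fix g assume g: "g \<in> H2"
  define c where "c = cinner g (monomial 0)"
  define g' where "g' = T (g - scaleC c (monomial 0))"
  have g': "g' \<in> H2" unfolding g'_def c_def by (rule backward_shift_H2[OF g])
  \<comment> \<open>Write \<open>g = c + z g'\<close>; the summand \<open>z g'\<close> contributes nothing because \<open>k\<close> is orthogonal to \<open>\<theta> g'\<close>.\<close>
  have "T g = g' + scaleC c (monomial (-1))"
    by (simp add: g'_def mult_op_diff Linf mult_op_scaleC mult_cnj_monomial)
  then have "T (M g) = M g' + scaleC c (T (abs_L2 \<theta>))"
    by (simp add: M_T[symmetric] mult_op_add mult_op_scaleC Linf)
      (simp add: M_T mult_cnj_monomial[of 0, simplified, symmetric] M_monomial_0)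
  then have "cinner (S k) (M g) = cinner k (M g') + cnj c * cinner k (T (abs_L2 \<theta>))"
    by (simp add: cinner_mult_ident cinner_add_right cinner_scaleC_right)
  also have "\<dots> = cnj c * cinner k k0"
    using kM[OF g'] kH by (simp add: T_theta cinner_add_right cinner_scaleC_right H2_iff)
  also have "cnj c = cinner (abs_L2 \<theta>) (M g)"
    unfolding c_def M_monomial_0[symmetric] cinner_M_M by (rule cinner_commute[symmetric])
  finally show "cinner (S k - scaleC (cinner k k0) (abs_L2 \<theta>)) (M g) = 0"
    by (simp add: cinner_diff_left cinner_scaleC_left)
qed

lemma Q_S_K_space: "k \<in> K_space \<theta> \<Longrightarrow> Q (S k) = scaleC (cinner k k0) (abs_L2 \<theta>)"
  by (intro Q_eqI S_K_space K_perp(3) theta_in_K_perp)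

text \<open>The correction term is dual to that of the preceding lemma.\<close>

lemma Q_T_K_perp:
  assumes h: "h \<in> K_perp \<theta>"
  shows "Q (T h) = T h - scaleC (cinner h (abs_L2 \<theta>)) k0"
proof (rule Q_eqI)
  show "T h - scaleC (cinner h (abs_L2 \<theta>)) k0 \<in> K_perp \<theta>"
    unfolding K_perp_iff
  proof
    fix k assume k: "k \<in> K_space \<theta>"
    have "cinner (T h) k = cinner h (Q (S k))"
      by (simp add: cinner_mult_cnj cinner_Q_right h)
    also have "\<dots> = cinner h (abs_L2 \<theta>) * cinner k0 k"
      using cinner_commute[of k0 k] by (simp add: Q_S_K_space k cinner_scaleC_right)
    finally show "cinner (T h - scaleC (cinner h (abs_L2 \<theta>)) k0) k = 0"
      by (simp add: cinner_diff_left cinner_scaleC_left)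
  qed
qed (simp add: K_space(3) k0_in_K_space)

lemma adjoint_compressed_shift:
  assumes h: "h \<in> K_perp \<theta>"
  shows "adjoint_on (K_perp \<theta>) (compressed_shift \<theta>) h = Q (T h)"
  by (rule adjoint_on_eqI[OF closed_csubspace_K_perp Q_in_K_perp])
    (simp add: compressed_shift_def cinner_Q_left cinner_Q_right h cinner_mult_ident)

text \<open>
  If \<open>g\<close> is in the kernel of the compressed shift, then \<open>z g\<close> is orthogonal to all negative powers
  of \<open>z\<close> and to all \<open>\<theta> z\<^sup>n\<close>, that is, \<open>g\<close> is orthogonal to these functions divided by \<open>z\<close>. Among the
  generators of the complement only \<open>1 / z\<close> is missing. The function \<open>\<theta> / z\<close> has component
  \<open>\<theta>0 / z\<close> in the complement, so that it supplies this generator exactly when \<open>\<theta>0 \<noteq> 0\<close>. For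
  \<open>\<theta>0 = 0\<close> the kernel is spanned by \<open>1 / z\<close> and one more condition is needed.
\<close>

lemma compressed_shift_eq_zero:
  assumes g: "g \<in> K_perp \<theta>" and 0: "compressed_shift \<theta> g = 0"
    and deg: "\<theta>0 = 0 \<Longrightarrow> cinner g (monomial (-1)) = 0"
  shows "g = 0"
proof -
  have T: "cinner g (T h) = 0" if "h \<in> K_perp \<theta>" for h
    using cinner_Q_left[OF that, of "S g"] 0 by (simp add: compressed_shift_def cinner_mult_ident)
  have "cinner g (T (abs_L2 \<theta>)) = 0" by (rule T[OF theta_in_K_perp])
  then have m1: "cinner g (monomial (-1)) = 0"
    using deg K_perp_orthogonal[OF g k0_in_K_space]
    by (cases "\<theta>0 = 0") (simp_all add: T_theta cinner_add_right cinner_scaleC_right)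
  show ?thesis
  proof (rule K_perp_eq_zero[OF g])
    fix n :: int
    show "cinner g (monomial n) = 0" if "n < 0"
      using m1 T[OF monomial_in_K_perp, of "n + 1"] that
      by (cases "n = -1") (auto simp: mult_cnj_monomial)
    show "cinner g (M (monomial n)) = 0" if "n \<ge> 0"
      using T[OF M_in_K_perp[OF monomial_in_H2], of "n + 1"] that
      by (simp add: M_T[symmetric] mult_cnj_monomial)
  qed
qed

section \<open>Operators that intertwine the compressed shift and its adjoint\<close>

text \<open>
  The adjoint of the compressed shift carries each \<open>z\<^sup>-\<^sup>n\<close>, \<open>n \<ge> 1\<close>, to \<open>z\<^sup>-\<^sup>n\<^sup>-\<^sup>1\<close>, hence \<open>D\<close> vanishes on all
  negative powers as soon as it vanishes on the first. It carries \<open>\<theta>\<close> to \<open>\<theta>0 / z\<close>, on which \<open>D\<close>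
  vanishes, and \<open>\<theta> z\<^sup>n\<^sup>+\<^sup>1\<close> to \<open>\<theta> z\<^sup>n\<close>. So the images of \<open>\<theta>, \<theta> z, \<theta> z\<^sup>2, \<dots>\<close> lie one after the other in the
  kernel of the compressed shift and are zero by the previous lemma; the hypothesis for \<open>\<theta>0 = 0\<close>
  keeps the range of \<open>D\<close> away from the kernel.
\<close>

theorem intertwining_operator_eq_zero:
  assumes D: "bounded_operator_on (K_perp \<theta>) D"
    and comm: "\<And>h. h \<in> K_perp \<theta> \<Longrightarrow> D (Q (T h)) = compressed_shift \<theta> (D h)"
    and D1: "D (monomial (-1)) = 0"
    and deg: "\<And>f. \<theta>0 = 0 \<Longrightarrow> f \<in> K_perp \<theta> \<Longrightarrow> cinner (D f) (monomial (-1)) = 0"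
    and h: "h \<in> K_perp \<theta>"
  shows "D h = 0"
proof -
  note DD = bounded_operator_onD[OF D]
  have shift0: "compressed_shift \<theta> 0 = 0"
    using Q_scaleC[of 0 "S 0"] mult_op_scaleC[OF Linf(3), of 0 0] by (simp add: compressed_shift_def)
  have inj: "D f = 0" if f: "f \<in> K_perp \<theta>" and "D (Q (T f)) = 0" for f
    using compressed_shift_eq_zero[OF DD(1)[OF f] _ deg[OF _ f]] comm[OF f] that(2) by simp
  have neg: "D (monomial (- int (Suc n))) = 0" for n
  proof (induction n)
    case 0
    then show ?case using D1 by simp
  next
    case (Suc n)
    have "Q (T (monomial (- int (Suc n)))) = monomial (- int (Suc (Suc n)))"
      by (subst mult_cnj_monomial, subst Q_K_perp) (auto intro: monomial_in_K_perp)
    then show ?case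
      using comm[OF monomial_in_K_perp, of "- int (Suc n)"] Suc shift0 by simp
  qed
  have pos: "D (M (monomial (int n))) = 0" for n
  proof (induction n)
    case 0
    have "Q (T (abs_L2 \<theta>)) = scaleC \<theta>0 (monomial (-1))"
      by (rule Q_eqI) (simp_all add: T_theta k0_in_K_space K_perp(3) monomial_in_K_perp)
    then have "D (Q (T (abs_L2 \<theta>))) = 0"
      using DD(3)[OF monomial_in_K_perp, of "-1" \<theta>0] D1 by simp
    then show ?case using inj[OF theta_in_K_perp] by (simp add: M_monomial_0)
  next
    case (Suc n)
    have "Q (T (M (monomial (int (Suc n))))) = M (monomial (int n))"
      by (simp add: M_T[symmetric] mult_cnj_monomial Q_K_perp M_in_K_perp monomial_in_H2)
    then show ?case using inj[OF M_in_K_perp[OF monomial_in_H2]] Suc by simp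
  qed
  \<comment> \<open>By density the adjoint of \<open>D\<close> vanishes; a limit argument in \<open>h\<close> is thereby avoided.\<close>
  have h_adj: "cinner h (adjoint_on (K_perp \<theta>) D g) = 0" for g
  proof -
    define w where "w = Q (adjoint_on (K_perp \<theta>) D g)"
    have w: "w \<in> K_perp \<theta>" and fw: "\<And>f. f \<in> K_perp \<theta> \<Longrightarrow> cinner f w = cinner (D f) g"
      using adjoint_on_cinner[OF closed_csubspace_K_perp D] by (auto simp: w_def Q_in_K_perp cinner_Q_right)
    have "w = 0"
    proof (rule K_perp_eq_zero[OF w])
      fix n :: int
      show "cinner w (monomial n) = 0" if "n < 0"
        using that neg[of "nat (- n - 1)"] fw[OF monomial_in_K_perp[OF that]]
        by (simp add: cinner_eq_zero_commute[of w])
      show "cinner w (M (monomial n)) = 0" if "n \<ge> 0"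
        using that pos[of "nat n"] fw[OF M_in_K_perp[OF monomial_in_H2[OF that]]]
        by (simp add: cinner_eq_zero_commute[of w])
    qed
    then show ?thesis using cinner_Q_right[OF h] by (metis cinner_zero_right w_def)
  qed
  have "cinner (D h) (D h) = 0"
    using adjoint_on_cinner[OF closed_csubspace_K_perp D h, of "D h"] h_adj by simp
  then show ?thesis by simp
qed

section \<open>The dual truncated Hankel operator\<close>

lemma bounded_dual_hankel:
  assumes \<phi>: "\<phi> \<in> Linf"
  shows "bounded_operator_on (K_perp \<theta>) (dual_hankel \<theta> \<phi>)"
proof -
  obtain C where C: "\<And>h. norm (mult_op \<phi> h) \<le> C * norm h" using norm_mult_op_le[OF \<phi>] by blast
  have "norm (dual_hankel \<theta> \<phi> h) \<le> C * norm h" for h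
    using norm_Q_le[of "flip (mult_op \<phi> h)"] C[of h] by (simp add: dual_hankel_def norm_flip)
  then show ?thesis
    unfolding bounded_operator_on_def
    by (auto simp: dual_hankel_def Q_in_K_perp mult_op_add mult_op_scaleC \<phi> flip_add flip_scaleC Q_add Q_scaleC)
qed

lemma alpha_eq_mult_k0:
  assumes \<phi>: "\<phi> \<in> Linf"
  shows "alpha \<theta> \<phi> = mult_op \<phi> k0"
proof -
  let ?f = "\<lambda>z. \<theta> z - \<theta>0 * 1"
  have f: "?f \<in> Linf" by (intro Linf_diff Linf_mult Linf_const Linf)
  have "abs_L2 \<theta> - scaleC \<theta>0 (monomial 0) = abs_L2 ?f"
    unfolding monomial_0
    by (simp add: scaleC_abs_L2 minus_abs_L2 square_integrable_Linf Linf_const Linf)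
  then have "k0 = abs_L2 (\<lambda>z. cnj z * ?f z)"
    by (simp add: k0_def mult_op_abs_L2 Linf square_integrable_Linf[OF f, simplified])
  moreover have "(\<lambda>z. cnj z * ?f z) \<in> Linf" by (intro Linf_mult f Linf)
  ultimately have "mult_op \<phi> k0 = abs_L2 (\<lambda>z. \<phi> z * (cnj z * ?f z))"
    by (simp only: mult_op_abs_L2 \<phi> square_integrable_Linf)
  then show ?thesis by (simp add: alpha_def mult.assoc)
qed

text \<open>
  The adjoint is multiplication by the conjugate of \<open>\<phi>\<close> after the flip; moving the flip past the
  conjugate symbol turns it into \<open>star \<phi>\<close>.
\<close>

lemma cinner_flip_mult_op:
  assumes \<phi>: "\<phi> \<in> Linf"
  shows "cinner (flip (mult_op \<phi> f)) g = cinner f (flip (mult_op (star \<phi>) g))"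
proof -
  have "flip (mult_op (star \<phi>) g) = mult_op (\<lambda>z. cnj (\<phi> z)) (flip g)"
    by (subst flip_mult_op[OF star_Linf[OF \<phi>]]) (simp add: star_def)
  then show ?thesis by (simp add: cinner_flip cinner_mult_op[OF \<phi>])
qed

text \<open>
  The flip turns division by \<open>z\<close> into multiplication by \<open>z\<close>, so without the compressions the two
  products would agree. The first rank one operator is the error of replacing \<open>x = J (\<phi> h)\<close> by its
  projection before multiplying by \<open>z\<close>, the second is the error of projecting \<open>h / z\<close>.
\<close>

theorem dual_hankel_commutator:
  assumes \<phi>: "\<phi> \<in> Linf" and h: "h \<in> K_perp \<theta>"
  shows "dual_hankel \<theta> \<phi> (Q (T h)) - compressed_shift \<theta> (dual_hankel \<theta> \<phi> h)
       = (abs_L2 \<theta> \<otimes>\<^sub>L Q (flip (alpha \<theta> (star \<phi>)))) h - (Q (flip (alpha \<theta> \<phi>)) \<otimes>\<^sub>L abs_L2 \<theta>) h"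
proof -
  define x where "x = flip (mult_op \<phi> h)"
  define k where "k = x - Q x"
  have k: "k \<in> K_space \<theta>" unfolding k_def by (rule diff_Q_in_K_space)
  have flipT: "flip (T f) = S (flip f)" for f by (simp add: flip_mult_op Linf)
  have "flip (mult_op \<phi> (T h)) = S x"
    by (simp add: x_def mult_op_commute[OF \<phi> Linf(4)] flipT)
  then have 1: "dual_hankel \<theta> \<phi> (Q (T h))
      = Q (S x) - scaleC (cinner h (abs_L2 \<theta>)) (Q (flip (alpha \<theta> \<phi>)))"
    by (simp add: dual_hankel_def Q_T_K_perp[OF h] mult_op_diff mult_op_scaleC \<phi> flip_diff flip_scaleC
        Q_diff Q_scaleC alpha_eq_mult_k0)
  have "Q (S x) = Q (S (Q x)) + Q (S k)"
    by (simp add: k_def mult_op_diff Linf Q_diff)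
  also have "Q (S k) = scaleC (cinner k k0) (abs_L2 \<theta>)" by (rule Q_S_K_space[OF k])
  also have "cinner k k0 = cinner x k0"
    using K_perp_orthogonal[OF Q_in_K_perp k0_in_K_space] by (simp add: k_def cinner_diff_left)
  also have "\<dots> = cinner h (Q (flip (alpha \<theta> (star \<phi>))))"
    by (simp add: x_def cinner_flip_mult_op \<phi> cinner_Q_right h alpha_eq_mult_k0 star_Linf)
  finally have 2: "Q (S x) = compressed_shift \<theta> (dual_hankel \<theta> \<phi> h)
      + scaleC (cinner h (Q (flip (alpha \<theta> (star \<phi>))))) (abs_L2 \<theta>)"
    by (simp add: compressed_shift_def dual_hankel_def x_def)
  show ?thesis by (simp add: 1 2 rank_one_def)
qed

end

lemma bounded_operator_on_diff:
  assumes M: "closed_csubspace M" and A: "bounded_operator_on M A" and B: "bounded_operator_on M B"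
  shows "bounded_operator_on M (\<lambda>h. A h - B h)"
proof -
  obtain C1 where C1: "\<And>f. f \<in> M \<Longrightarrow> norm (A f) \<le> C1 * norm f"
    using A unfolding bounded_operator_on_def by blast
  obtain C2 where C2: "\<And>f. f \<in> M \<Longrightarrow> norm (B f) \<le> C2 * norm f"
    using B unfolding bounded_operator_on_def by blast
  have "norm (A f - B f) \<le> (C1 + C2) * norm f" if "f \<in> M" for f
    using norm_triangle_ineq4[of "A f" "B f"] C1[OF that] C2[OF that] by (simp add: distrib_right)
  then show ?thesis
    using bounded_operator_onD[OF A] bounded_operator_onD[OF B] closed_csubspaceD[OF M]
    unfolding bounded_operator_on_def by (auto simp: scaleC_diff_right)
qed

theorem theorem3p13:
  fixes \<theta> \<phi> :: "complex \<Rightarrow> complex" and A :: "L2 \<Rightarrow> L2"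
  assumes "inner_fun \<theta>"
    and "\<phi> \<in> Linf"
    and "bounded_operator_on (K_perp \<theta>) A"
    and "\<forall>h\<in>K_perp \<theta>.
           A (adjoint_on (K_perp \<theta>) (compressed_shift \<theta>) h) - compressed_shift \<theta> (A h)
         = (abs_L2 \<theta> \<otimes>\<^sub>L proj_Q\<theta> \<theta> (flip (alpha \<theta> (star \<phi>)))) h
           - (proj_Q\<theta> \<theta> (flip (alpha \<theta> \<phi>)) \<otimes>\<^sub>L abs_L2 \<theta>) h"
  shows "(fourier_coeff \<theta> 0 \<noteq> 0 \<longrightarrow>
            ((\<forall>h\<in>K_perp \<theta>. A h = dual_hankel \<theta> \<phi> h) \<longleftrightarrow>
             A (abs_L2 cnj) = dual_hankel \<theta> \<phi> (abs_L2 cnj)))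
       \<and> (fourier_coeff \<theta> 0 = 0 \<longrightarrow>
            ((\<forall>h\<in>K_perp \<theta>. A h = dual_hankel \<theta> \<phi> h) \<longleftrightarrow>
             A (abs_L2 cnj) = dual_hankel \<theta> \<phi> (abs_L2 cnj) \<and>
             adjoint_on (K_perp \<theta>) A (abs_L2 cnj)
               = adjoint_on (K_perp \<theta>) (dual_hankel \<theta> \<phi>) (abs_L2 cnj)))"
proof -
  interpret inner_function \<theta> by standard (rule assms(1))
  let ?H = "dual_hankel \<theta> \<phi>"
  let ?adj = "adjoint_on (K_perp \<theta>)"
  define D where "D h = A h - ?H h" for h
  have H: "bounded_operator_on (K_perp \<theta>) ?H" by (rule bounded_dual_hankel[OF assms(2)])
  have D: "bounded_operator_on (K_perp \<theta>) D"
    unfolding D_def by (rule bounded_operator_on_diff[OF closed_csubspace_K_perp assms(3) H])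
  \<comment> \<open>The rank one terms cancel in the difference.\<close>
  have comm: "D (Q (T h)) = compressed_shift \<theta> (D h)" if h: "h \<in> K_perp \<theta>" for h
  proof -
    have "A (Q (T h)) - compressed_shift \<theta> (A h) = ?H (Q (T h)) - compressed_shift \<theta> (?H h)"
      using bspec[OF assms(4) h]
      by (simp only: adjoint_compressed_shift[OF h] dual_hankel_commutator[OF assms(2) h])
    then show ?thesis
      by (simp add: D_def compressed_shift_def mult_op_diff Linf Q_diff algebra_simps)
  qed
  have zbar: "abs_L2 cnj \<in> K_perp \<theta>" by (simp add: abs_L2_cnj monomial_in_K_perp)
  \<comment> \<open>The condition on the adjoints says that the range of \<open>D\<close> is orthogonal to \<open>1 / z\<close>.\<close>
  have sufficient: "A h = ?H h"
    if "A (abs_L2 cnj) = ?H (abs_L2 cnj)"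
      and "\<theta>0 = 0 \<Longrightarrow> ?adj A (abs_L2 cnj) = ?adj ?H (abs_L2 cnj)"
      and h: "h \<in> K_perp \<theta>" for h
  proof -
    have "cinner (D f) (monomial (-1)) = 0" if "\<theta>0 = 0" "f \<in> K_perp \<theta>" for f
      using adjoint_on_cinner[OF closed_csubspace_K_perp assms(3) that(2), of "abs_L2 cnj"]
        adjoint_on_cinner[OF closed_csubspace_K_perp H that(2), of "abs_L2 cnj"]
        \<open>\<theta>0 = 0 \<Longrightarrow> ?adj A (abs_L2 cnj) = ?adj ?H (abs_L2 cnj)\<close>[OF that(1)]
      by (simp add: D_def cinner_diff_left abs_L2_cnj)
    moreover have "D (monomial (-1)) = 0" using that(1) by (simp add: D_def abs_L2_cnj)
    ultimately have "D h = 0" using intertwining_operator_eq_zero[OF D comm _ _ h] by blast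
    then show ?thesis by (simp add: D_def)
  qed
  \<comment> \<open>The operators may differ off the subspace, but the adjoint depends only on the values there.\<close>
  have necessary: "?adj A g = ?adj ?H g" if "\<forall>h\<in>K_perp \<theta>. A h = ?H h" for g
  proof -
    have "(\<forall>f\<in>K_perp \<theta>. cinner (A f) g = cinner f w) \<longleftrightarrow> (\<forall>f\<in>K_perp \<theta>. cinner (?H f) g = cinner f w)" for w
      using that by auto
    then show ?thesis by (simp add: adjoint_on_def)
  qed
  show ?thesis using sufficient necessary zbar by blast
qed

end
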